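(* Assume $MA_{\omega_1}$. Let $L$ and $K$ be separable, $\omega_1$-dense, rectangular linear orders. Then $K\cong L$ if and only if there is no uncountable linear order that embeds both into $K$ and into $L^*$, where $L^*$ is $L$ with the reversed order.
   Context: A linear order is $\omega_1$-dense if every nonempty open interval has cardinality $\omega_1$, and separable if it has a countable subset meeting every nonempty open interval. For a linear order $(X,<)$, tuples $(x_1,\dots,x_n),(y_1,\dots,y_n)\in X^n$ with disjoint entry sets are alike if: for all $i,j$, ($x_i<y_i\iff x_j<y_j$); for all $i,j$, ($x_i<x_j\iff y_i<y_j$); and for all $i,j$ with $x_i\neq x_j$, ($x_i<x_j\iff x_i<y_j\iff y_i<x_j$). The order is rectangular if it is uncountable and for every $n$ and every family of $\omega_1$ many tuples in $X^n$ with pairwise disjoint entry sets, two distinct members are alike.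
   Formalization: ω₁-dense is taken in the standard sense: every open interval (a,b) with a<b and every open ray is nonempty of cardinality ω₁, so no endpoints or jumps; if empty intervals were allowed, K and L = K plus a top element would be a counterexample. *)

theory Defs
  imports "HOL-Library.Countable_Set"
begin

unbundle cardinal_syntax

(* A linear order is a reflexive relation r with Linear_order r; its underlying set is Field r,
   its strict part is r - Id, and the reversed order is the converse of r. *)

abbreviation omega1 :: "nat set rel"
  where "omega1 \<equiv> cardSuc natLeq"


subsection \<open>Martin's axiom for \<open>\<aleph>\<^sub>1\<close> dense sets\<close>

(* (p, q) \<in> r is read as: p is below q, i.e. p is a stronger condition than q. *)

definition compatible_in :: "'p set \<Rightarrow> 'p rel \<Rightarrow> 'p \<Rightarrow> 'p \<Rightarrow> bool"
  where "compatible_in P r p q \<longleftrightarrow> (\<exists>s\<in>P. (s, p) \<in> r \<and> (s, q) \<in> r)"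

definition ccc_on :: "'p set \<Rightarrow> 'p rel \<Rightarrow> bool"
  where "ccc_on P r \<longleftrightarrow>
    (\<forall>A\<subseteq>P. pairwise (\<lambda>p q. \<not> compatible_in P r p q) A \<longrightarrow> countable A)"

definition dense_in_poset :: "'p set \<Rightarrow> 'p rel \<Rightarrow> 'p set \<Rightarrow> bool"
  where "dense_in_poset P r D \<longleftrightarrow> D \<subseteq> P \<and> (\<forall>p\<in>P. \<exists>d\<in>D. (d, p) \<in> r)"

definition poset_filter :: "'p set \<Rightarrow> 'p rel \<Rightarrow> 'p set \<Rightarrow> bool"
  where "poset_filter P r G \<longleftrightarrow>
    G \<subseteq> P \<and> G \<noteq> {} \<and>
    (\<forall>p\<in>G. \<forall>q\<in>P. (p, q) \<in> r \<longrightarrow> q \<in> G) \<and>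
    (\<forall>p\<in>G. \<forall>q\<in>G. \<exists>s\<in>G. (s, p) \<in> r \<and> (s, q) \<in> r)"

(* HOL cannot quantify over all types, so the posets range over those whose underlying set is a
   set of elements of the type nat set (of cardinality continuum). By the usual closing-off
   argument the axiom for all ccc posets follows from its instances for posets of cardinality
   at most omega1, and all of these have copies here. *)

definition MA_omega1 :: bool
  where "MA_omega1 \<longleftrightarrow>
    (\<forall>(P :: nat set set) r \<D>.
       P \<noteq> {} \<and> preorder_on P r \<and> ccc_on P r \<and>
       |\<D>| \<le>o omega1 \<and> (\<forall>D\<in>\<D>. dense_in_poset P r D) \<longrightarrow>
       (\<exists>G. poset_filter P r G \<and> (\<forall>D\<in>\<D>. G \<inter> D \<noteq> {})))"


subsection \<open>Separable and \<open>\<omega>\<^sub>1\<close>-dense linear orders\<close>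

(* Intervals may be unbounded on either side. *)

definition open_intervals :: "'a rel \<Rightarrow> 'a set set"
  where "open_intervals r =
    {aboveS r a \<inter> underS r b | a b. (a, b) \<in> r - Id} \<union>
    aboveS r ` Field r \<union> underS r ` Field r \<union> {Field r}"

definition separable_order :: "'a rel \<Rightarrow> bool"
  where "separable_order r \<longleftrightarrow>
    (\<exists>C\<subseteq>Field r. countable C \<and> (\<forall>I\<in>open_intervals r. I \<noteq> {} \<longrightarrow> C \<inter> I \<noteq> {}))"

(* As usual for kappa-dense orders, every interval (a, b) with a < b, and every open ray, is
   required to have cardinality omega1: the order has neither jumps nor endpoints. Letting empty
   intervals and rays pass would admit an order with a top element added, or with one point
   doubled; these are not isomorphic to the original order, but remain separable and rectangular and
   have, up to deleting one point, the same uncountable suborders. *)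

definition omega1_dense :: "'a rel \<Rightarrow> bool"
  where "omega1_dense r \<longleftrightarrow>
    (\<forall>I\<in>open_intervals r. I \<noteq> {}) \<and>
    (\<forall>I\<in>open_intervals r. I \<noteq> {} \<longrightarrow> |I| =o omega1)"


subsection \<open>Rectangular linear orders\<close>

(* Tuples are lists of equal length; disjointness of the entry sets is imposed in
   rectangular_order, the only place where alike is used. *)

definition alike :: "'a rel \<Rightarrow> 'a list \<Rightarrow> 'a list \<Rightarrow> bool"
  where "alike r x y \<longleftrightarrow>
    (\<forall>i<length x. \<forall>j<length x.
       ((x ! i, y ! i) \<in> r - Id \<longleftrightarrow> (x ! j, y ! j) \<in> r - Id) \<and>
       ((x ! i, x ! j) \<in> r - Id \<longleftrightarrow> (y ! i, y ! j) \<in> r - Id) \<and>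
       (x ! i \<noteq> x ! j \<longrightarrow>
          ((x ! i, x ! j) \<in> r - Id \<longleftrightarrow> (x ! i, y ! j) \<in> r - Id) \<and>
          ((x ! i, y ! j) \<in> r - Id \<longleftrightarrow> (y ! i, x ! j) \<in> r - Id)))"

definition rectangular_order :: "'a rel \<Rightarrow> bool"
  where "rectangular_order r \<longleftrightarrow>
    uncountable (Field r) \<and>
    (\<forall>n. \<forall>\<F> \<subseteq> {x. length x = n \<and> set x \<subseteq> Field r}.
       |\<F>| =o omega1 \<and> pairwise (\<lambda>x y. set x \<inter> set y = {}) \<F> \<longrightarrow>
       (\<exists>x\<in>\<F>. \<exists>y\<in>\<F>. x \<noteq> y \<and> alike r x y))"


subsection \<open>Embeddings and isomorphisms\<close>

definition order_embeds :: "'c rel \<Rightarrow> 'a rel \<Rightarrow> bool"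
  where "order_embeds s r \<longleftrightarrow>
    (\<exists>f. f ` Field s \<subseteq> Field r \<and>
         (\<forall>x\<in>Field s. \<forall>y\<in>Field s. (x, y) \<in> s - Id \<longleftrightarrow> (f x, f y) \<in> r - Id))"

(* By iso_iff2, the library's iso is a bijection of fields preserving the relation in both
   directions, for arbitrary relations. *)

definition order_isomorphic :: "'a rel \<Rightarrow> 'b rel \<Rightarrow> bool"
  where "order_isomorphic r s \<longleftrightarrow> (\<exists>f. iso r s f)"

(* Any order that embeds into r has a copy on a subset of Field r, so it is enough to let M
   range over relations on the same type as r. *)

definition common_uncountable_suborder :: "'a rel \<Rightarrow> 'b rel \<Rightarrow> bool"
  where "common_uncountable_suborder r s \<longleftrightarrow>
    (\<exists>M :: 'a rel. Linear_order M \<and> uncountable (Field M) \<and>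
       order_embeds M r \<and> order_embeds M s)"

end

theory Submission
  imports Defs "HOL-Library.Countable_Set_Type"
begin

text \<open>Two disjoint alike tuples move all their coordinates in the same direction, and no entry jumps
  over a different entry. Hence \<open>F \<union> G\<close> is pairwise alike as soon as the concatenations of two finite
  pairwise alike families \<open>F\<close>, \<open>G\<close> of tuples are alike; by rectangularity the poset of such families is
  ccc, and \<open>MA\<close> thins every uncountable disjoint family of tuples to an uncountable pairwise alike one.

  An isomorphism \<open>K \<cong> L\<close> is generic for the finite increasing partial maps whose graph lies in a fixed
  relation \<open>E \<subseteq> K \<times> L\<close> with countable fibres and dense sections. For ccc, thin an
  uncountable family of conditions until their \<open>K\<close>-parts and their \<open>L\<close>-parts are pairwise alike.
  Sending the first \<open>K\<close>-entry of a condition to its first \<open>L\<close>-entry is not a decreasing map, as \<open>K\<close>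
  and \<open>L\<^sup>*\<close> have no common uncountable suborder, so two conditions move upwards in both
  parts and are compatible. Conversely, if \<open>K \<cong> L\<close>, a common suborder of \<open>K\<close> and \<open>L\<^sup>*\<close>
  gives a decreasing injection between uncountable subsets of \<open>L\<close>, whose graph contains no two
  disjoint alike pairs.\<close>


subsection \<open>Cardinality\<close>

lemma Card_order_omega1: "Card_order omega1"
  by (simp add: cardSuc_Card_order natLeq_Card_order)

lemma infinite_Field_omega1: "infinite (Field omega1)"
  using cardSuc_finite[OF natLeq_Card_order] by (simp add: Field_natLeq)

lemma countable_iff_ordLess_omega1: "countable A \<longleftrightarrow> |A| <o omega1"
  by (simp add: countable_card_le_natLeq cardSuc_ordLeq_ordLess natLeq_Card_order card_of_Card_order)

lemma countable_ordLeq_omega1: "countable A \<Longrightarrow> |A| \<le>o omega1"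
  by (simp add: countable_iff_ordLess_omega1 ordLess_imp_ordLeq)

lemma uncountable_if_ordIso_omega1: "|A| =o omega1 \<Longrightarrow> uncountable A"
  by (metis countable_iff_ordLess_omega1 not_ordLess_ordIso)

text \<open>\<open>card_of_ordLeq\<close> turns comparisons between cardinalities of sets into
  injections, so \<open>omega1\<close> is replaced by the cardinality of its field.\<close>

lemma ordLeq_omega1_iff: "|A| \<le>o omega1 \<longleftrightarrow> |A| \<le>o |Field omega1|"
  by (meson Card_order_omega1 card_of_Field_ordIso ordIso_symmetric ordLeq_ordIso_trans)

text \<open>Cardinals are comparable, so the field of \<open>omega1\<close> injects into every
  uncountable set. This carries statements about families of size exactly \<open>omega1\<close> over
  to uncountable ones.\<close>

lemma uncountable_obtain_omega1:
  assumes "uncountable A"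
  obtains B where "B \<subseteq> A" "|B| =o omega1"
proof -
  have "omega1 \<le>o |A|"
    using assms Card_order_omega1
    by (metis card_order_on_well_order_on card_of_Card_order countable_iff_ordLess_omega1 not_ordLess_iff_ordLeq)
  then have "|Field omega1| \<le>o |A|"
    using Card_order_omega1 card_of_Field_ordIso ordIso_ordLeq_trans by blast
  then obtain f where f: "inj_on f (Field omega1)" "f ` Field omega1 \<subseteq> A"
    by (meson card_of_ordLeq)
  have "|f ` Field omega1| =o |Field omega1|"
    using f(1) by (meson card_of_ordIsoI inj_on_imp_bij_betw ordIso_symmetric)
  then have "|f ` Field omega1| =o omega1"
    using Card_order_omega1 card_of_Field_ordIso ordIso_transitive by blast
  with f(2) that show thesis by blast
qed

lemma subset_ordLeq_omega1: "A \<subseteq> B \<Longrightarrow> |B| \<le>o omega1 \<Longrightarrow> |A| \<le>o omega1"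
  using card_of_mono1 ordLeq_transitive by blast

lemma image_ordLeq_omega1: "|A| \<le>o omega1 \<Longrightarrow> |f ` A| \<le>o omega1"
  using card_of_image ordLeq_transitive by blast

lemma Un_ordLeq_omega1: "|A| \<le>o omega1 \<Longrightarrow> |B| \<le>o omega1 \<Longrightarrow> |A \<union> B| \<le>o omega1"
  by (rule card_of_Un_ordLeq_infinite_Field[OF infinite_Field_omega1 _ _ Card_order_omega1])

lemma Times_ordLeq_omega1: "|A| \<le>o omega1 \<Longrightarrow> |B| \<le>o omega1 \<Longrightarrow> |A \<times> B| \<le>o omega1"
  by (rule card_of_Times_ordLeq_infinite_Field[OF infinite_Field_omega1 _ _ Card_order_omega1])

text \<open>A set of size \<open>Suc n\<close> arises by inserting a point into one of size
  \<open>n\<close>, so each size contributes at most \<open>omega1\<close> sets, and there are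
  countably many sizes.\<close>

lemma Fpow_ordLeq_omega1:
  assumes "|X| \<le>o omega1"
  shows "|Fpow X| \<le>o omega1"
proof -
  define F where "F n = {S. S \<subseteq> X \<and> finite S \<and> card S = n}" for n :: nat
  have F: "|F n| \<le>o omega1" for n
  proof (induction n)
    case 0
    have "F 0 = {{}}" by (auto simp: F_def)
    then show ?case by (simp add: countable_ordLeq_omega1)
  next
    case (Suc n)
    have "F (Suc n) \<subseteq> (\<lambda>(x, S). insert x S) ` (X \<times> F n)"
    proof
      fix S assume S: "S \<in> F (Suc n)"
      then obtain x T where "S = insert x T" "x \<notin> T" "card T = n" "finite T"
        by (auto simp: F_def card_Suc_eq_finite)
      with S show "S \<in> (\<lambda>(x, S). insert x S) ` (X \<times> F n)"
        by (auto simp: F_def intro!: image_eqI[of _ _ "(x, T)"])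
    qed
    then show ?case
      using Times_ordLeq_omega1[OF assms Suc] image_ordLeq_omega1 subset_ordLeq_omega1 by blast
  qed
  have "|\<Union>n\<in>UNIV. F n| \<le>o omega1"
    by (rule card_of_UNION_ordLeq_infinite_Field[OF infinite_Field_omega1])
      (use F countable_ordLeq_omega1[of "UNIV :: nat set"] in \<open>auto simp: Card_order_omega1\<close>)
  moreover have "Fpow X \<subseteq> (\<Union>n. F n)" by (auto simp: F_def Fpow_def)
  ultimately show ?thesis using subset_ordLeq_omega1 by blast
qed


subsection \<open>Uncountable families of sets\<close>

text \<open>Zorn's lemma gives a maximal independent set \<open>M\<close>. Every other point of
  \<open>A\<close> is related to a member of \<open>M\<close>, so \<open>A\<close> is covered by
  \<open>M\<close> and the countable neighbourhoods of its members.\<close>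

lemma uncountable_independent_subset:
  assumes "uncountable A"
    and countable: "\<And>i. i \<in> A \<Longrightarrow> countable {j \<in> A. \<rho> i j}"
    and sym: "\<And>i j. \<rho> i j \<Longrightarrow> \<rho> j i"
  obtains B where "B \<subseteq> A" "uncountable B" "pairwise (\<lambda>i j. \<not> \<rho> i j) B"
proof -
  let ?\<B> = "{B. B \<subseteq> A \<and> pairwise (\<lambda>i j. \<not> \<rho> i j) B}"
  have "\<exists>M\<in>?\<B>. \<forall>B\<in>?\<B>. M \<subseteq> B \<longrightarrow> B = M"
  proof (rule subset_Zorn')
    fix \<C> assume \<C>: "subset.chain ?\<B> \<C>"
    have "pairwise (\<lambda>i j. \<not> \<rho> i j) (\<Union>\<C>)"
      by (rule pairwise_chain_Union) (use \<C> in \<open>auto simp: subset_chain_def chain_subset_def\<close>)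
    with \<C> show "\<Union>\<C> \<in> ?\<B>" by (auto simp: subset_chain_def)
  qed
  then obtain M where M: "M \<subseteq> A" "pairwise (\<lambda>i j. \<not> \<rho> i j) M"
    and max: "\<And>B. B \<subseteq> A \<Longrightarrow> pairwise (\<lambda>i j. \<not> \<rho> i j) B \<Longrightarrow> M \<subseteq> B \<Longrightarrow> B = M"
    by auto
  have "A \<subseteq> M \<union> (\<Union>i\<in>M. {j \<in> A. \<rho> i j})"
  proof
    fix j assume "j \<in> A"
    show "j \<in> M \<union> (\<Union>i\<in>M. {j \<in> A. \<rho> i j})"
    proof (rule ccontr)
      assume j: "\<not> ?thesis"
      with \<open>j \<in> A\<close> M have "pairwise (\<lambda>i j. \<not> \<rho> i j) (insert j M)"
        using sym by (auto simp: pairwise_insert)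
      with max[of "insert j M"] \<open>j \<in> A\<close> M(1) j show False by blast
    qed
  qed
  moreover have "countable (M \<union> (\<Union>i\<in>M. {j \<in> A. \<rho> i j}))" if "countable M"
    using that countable M(1) by blast
  ultimately have "uncountable M"
    using \<open>uncountable A\<close> countable_subset by blast
  with M that show thesis by blast
qed

text \<open>Think of \<open>C i\<close> as the points in conflict with \<open>f i\<close>. Each of
  the countably many points of \<open>C j\<close> lies in countably many \<open>f i\<close>, so
  every index conflicts with only countably many others.\<close>

lemma uncountable_avoiding_subfamily:
  assumes "uncountable A"
    and "\<And>e. countable {i \<in> A. e \<in> f i}" and "\<And>i. i \<in> A \<Longrightarrow> countable (C i)"
    and sym: "\<And>i j. f i \<inter> C j \<noteq> {} \<Longrightarrow> f j \<inter> C i \<noteq> {}"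
  obtains B where "B \<subseteq> A" "uncountable B" "pairwise (\<lambda>i j. f i \<inter> C j = {}) B"
proof -
  have "countable {i \<in> A. f i \<inter> C j \<noteq> {}}" if "j \<in> A" for j
  proof -
    have "{i \<in> A. f i \<inter> C j \<noteq> {}} = (\<Union>e\<in>C j. {i \<in> A. e \<in> f i})" by blast
    then show ?thesis using assms(2,3) that by simp
  qed
  from this sym obtain B where "B \<subseteq> A" "uncountable B" "pairwise (\<lambda>i j. \<not> f j \<inter> C i \<noteq> {}) B"
    by (rule uncountable_independent_subset[OF assms(1), of "\<lambda>i j. f j \<inter> C i \<noteq> {}"])
  with that[of B] show thesis by (auto simp: pairwise_def)
qed

lemma uncountable_same_value:
  fixes f :: "'i \<Rightarrow> nat"
  assumes "uncountable A"
  obtains n where "uncountable {i \<in> A. f i = n}"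
proof -
  have "A = (\<Union>n. {i \<in> A. f i = n})" by blast
  then show thesis using assms that by (metis (lifting) countable_UN countableI_type)
qed

text \<open>Induction on the size: a point lying in uncountably many of the sets is removed from
  them and put into the root; if there is none, an uncountable pairwise disjoint subfamily exists,
  with empty root.\<close>

lemma Delta_system_card:
  fixes n :: nat
  assumes "uncountable A" and "\<And>i. i \<in> A \<Longrightarrow> finite (S i) \<and> card (S i) = n"
  shows "\<exists>B R. B \<subseteq> A \<and> uncountable B \<and> pairwise (\<lambda>i j. S i \<inter> S j = R) B"
  using assms
proof (induction n arbitrary: A S)
  case 0
  then have "S i = {}" if "i \<in> A" for i using that card_0_eq by blast
  then show ?case using "0.prems"(1) by (intro exI[of _ A] exI[of _ "{}"]) (auto simp: pairwise_def)
next
  case (Suc n)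
  show ?case
  proof (cases "\<exists>x. uncountable {i \<in> A. x \<in> S i}")
    case True
    then obtain x where x: "uncountable {i \<in> A. x \<in> S i}" by blast
    have "\<exists>B R. B \<subseteq> {i \<in> A. x \<in> S i} \<and> uncountable B \<and>
      pairwise (\<lambda>i j. (S i - {x}) \<inter> (S j - {x}) = R) B"
      using x Suc.prems(2) by (intro Suc.IH) auto
    then obtain B R where B: "B \<subseteq> {i \<in> A. x \<in> S i}" "uncountable B"
      "pairwise (\<lambda>i j. (S i - {x}) \<inter> (S j - {x}) = R) B" by blast
    have "S i \<inter> S j = insert x R" if "i \<in> B" "j \<in> B" "i \<noteq> j" for i j
    proof -
      have "x \<in> S i" "x \<in> S j" "(S i - {x}) \<inter> (S j - {x}) = R"
        using that B by (auto simp: pairwise_def)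
      then show ?thesis by blast
    qed
    then have "pairwise (\<lambda>i j. S i \<inter> S j = insert x R) B" by (simp add: pairwise_def)
    with B(1,2) show ?thesis by blast
  next
    case False
    have "\<exists>B\<subseteq>A. uncountable B \<and> pairwise (\<lambda>i j. S i \<inter> S j = {}) B"
      by (rule uncountable_avoiding_subfamily[OF Suc.prems(1), of S S])
        (use False Suc.prems(2) in \<open>auto intro: countable_finite\<close>)
    then show ?thesis by blast
  qed
qed

lemma Delta_system:
  assumes "uncountable A" and "\<And>i. i \<in> A \<Longrightarrow> finite (S i)"
  obtains B R where "B \<subseteq> A" "uncountable B" "pairwise (\<lambda>i j. S i \<inter> S j = R) B"
proof -
  obtain n where "uncountable {i \<in> A. card (S i) = n}"
    using uncountable_same_value[OF assms(1)] .
  from Delta_system_card[OF this, of S n] assms(2) that show thesis by auto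
qed


subsection \<open>Finite cliques\<close>

text \<open>Both forcings below have conditions of this form. As \<open>pairwise\<close> runs over
  ordered pairs, \<open>H\<close> is required in both directions.\<close>

definition finite_cliques :: "'x set \<Rightarrow> ('x \<Rightarrow> 'x \<Rightarrow> bool) \<Rightarrow> 'x set set"
  where "finite_cliques X H = {p \<in> Fpow X. pairwise H p}"

text \<open>This is the ccc for finite cliques ordered by reverse inclusion: \<open>p\<close> and
  \<open>q\<close> have a common extension exactly if \<open>p \<union> q\<close> is a
  clique.\<close>

definition ccc_cliques :: "'x set \<Rightarrow> ('x \<Rightarrow> 'x \<Rightarrow> bool) \<Rightarrow> bool"
  where "ccc_cliques X H \<longleftrightarrow> (\<forall>\<A>\<subseteq>finite_cliques X H. uncountable \<A> \<longrightarrow>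
    (\<exists>p\<in>\<A>. \<exists>q\<in>\<A>. p \<noteq> q \<and> pairwise H (p \<union> q)))"

text \<open>A Delta-system reduces the ccc to pairwise disjoint conditions of equal length: pairs
  involving the root \<open>R\<close> lie inside \<open>p\<close> or inside \<open>q\<close>, so
  only \<open>p - R\<close> against \<open>q - R\<close> is at stake. Lists supply the enumeration
  needed to form tuples.\<close>

lemma ccc_cliquesI:
  assumes lists: "\<And>n \<Lambda>. \<lbrakk>uncountable \<Lambda>;
      \<And>l. l \<in> \<Lambda> \<Longrightarrow> length l = n \<and> set l \<in> finite_cliques X H;
      pairwise (\<lambda>l l'. set l \<inter> set l' = {}) \<Lambda>\<rbrakk> \<Longrightarrow>
    \<exists>l\<in>\<Lambda>. \<exists>l'\<in>\<Lambda>. l \<noteq> l' \<and> pairwise H (set l \<union> set l')"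
  shows "ccc_cliques X H"
  unfolding ccc_cliques_def
proof (intro allI impI)
  fix \<A> assume \<A>: "\<A> \<subseteq> finite_cliques X H" "uncountable \<A>"
  obtain \<B> R
    where \<B>: "\<B> \<subseteq> \<A>" "uncountable \<B>" "pairwise (\<lambda>p q. p \<inter> q = R) \<B>"
    by (rule Delta_system[of \<A> "\<lambda>p. p"]) (use \<A> in \<open>auto simp: finite_cliques_def Fpow_def\<close>)
  have R: "R \<subseteq> p" if p: "p \<in> \<B>" for p
  proof -
    have "\<B> \<noteq> {p}" using \<B>(2) by auto
    then obtain q where "q \<in> \<B>" "q \<noteq> p" using p by blast
    with p \<B>(3) show ?thesis by (auto simp: pairwise_def)
  qed
  \<comment> \<open>Any enumeration will do, with or without repetitions, since only its set and its
    length matter.\<close>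
  define e where "e p = (SOME l. set l = p - R)" for p
  have e: "set (e p) = p - R" if "p \<in> \<B>" for p
  proof -
    have "finite (p - R)" using that \<A>(1) \<B>(1) by (auto simp: finite_cliques_def Fpow_def)
    then show ?thesis unfolding e_def by (rule someI_ex[OF finite_list])
  qed
  have e_inj: "p = q" if "p \<in> \<B>" "q \<in> \<B>" "e p = e q" for p q
    using R[OF that(1)] R[OF that(2)] e[OF that(1)] e[OF that(2)] that(3) by auto
  obtain n where n: "uncountable {p \<in> \<B>. length (e p) = n}"
    using uncountable_same_value[OF \<B>(2), of "\<lambda>p. length (e p)"] .
  define \<Lambda> where "\<Lambda> = e ` {p \<in> \<B>. length (e p) = n}"
  have "\<exists>l\<in>\<Lambda>. \<exists>l'\<in>\<Lambda>. l \<noteq> l' \<and> pairwise H (set l \<union> set l')"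
  proof (rule lists)
    show "uncountable \<Lambda>"
      using n e_inj unfolding \<Lambda>_def by (subst countable_image_inj_eq) (auto simp: inj_on_def)
    show "length l = n \<and> set l \<in> finite_cliques X H" if "l \<in> \<Lambda>" for l
    proof -
      from that obtain p where p: "p \<in> \<B>" "l = e p" "length l = n" by (auto simp: \<Lambda>_def)
      then have "p \<in> finite_cliques X H" using \<A>(1) \<B>(1) by blast
      then have "p - R \<in> finite_cliques X H"
        by (auto simp: finite_cliques_def Fpow_def intro: pairwise_subset)
      with p e show ?thesis by simp
    qed
    show "pairwise (\<lambda>l l'. set l \<inter> set l' = {}) \<Lambda>"
    proof (rule pairwiseI)
      fix l l' assume "l \<in> \<Lambda>" "l' \<in> \<Lambda>" "l \<noteq> l'"
      then obtain p q where pq: "p \<in> \<B>" "q \<in> \<B>" "l = e p" "l' = e q" "p \<noteq> q"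
        by (auto simp: \<Lambda>_def)
      then have "p \<inter> q = R" using \<B>(3) by (simp add: pairwise_def)
      with pq show "set l \<inter> set l' = {}" using e[OF pq(1)] e[OF pq(2)] by blast
    qed
  qed
  then obtain p q where pq: "p \<in> \<B>" "q \<in> \<B>" "p \<noteq> q" "pairwise H ((p - R) \<union> (q - R))"
    using e by (auto simp: \<Lambda>_def)
  moreover have "pairwise H p" "pairwise H q"
    using pq \<A>(1) \<B>(1) by (auto simp: finite_cliques_def)
  ultimately have "pairwise H (p \<union> q)"
    using R[OF pq(1)] R[OF pq(2)] unfolding pairwise_def by blast
  with pq \<B>(1) show "\<exists>p\<in>\<A>. \<exists>q\<in>\<A>. p \<noteq> q \<and> pairwise H (p \<union> q)" by blast
qed

section \<open>Martin's axiom for posets of finite cliques\<close>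

lemma MA_omega1_transport:
  fixes P :: "'p set" and r :: "'p rel"
  assumes MA: "MA_omega1" and P: "P \<noteq> {}" "|P| \<le>o omega1" and r: "preorder_on P r" "ccc_on P r"
    and \<D>: "|\<D>| \<le>o omega1" "\<And>D. D \<in> \<D> \<Longrightarrow> dense_in_poset P r D"
  obtains G where "poset_filter P r G" "\<forall>D\<in>\<D>. G \<inter> D \<noteq> {}"
proof -
  \<comment> \<open>\<open>MA_omega1\<close> is about posets of elements of type
    \<open>nat set\<close>. The field of \<open>omega1\<close> has that element type, so
    \<open>P\<close> injects into it, and the poset and the dense sets are carried along
    \<open>g\<close>.\<close>
  obtain g :: "'p \<Rightarrow> nat set" where g: "inj_on g P"
    using P(2) unfolding ordLeq_omega1_iff by (meson card_of_ordLeq)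
  define r' where "r' = map_prod g g ` r"
  have rP: "r \<subseteq> P \<times> P" "refl_on P r" "trans r"
    using r(1) by (auto simp: preorder_on_def)
  have r'_iff: "(g p, g q) \<in> r' \<longleftrightarrow> (p, q) \<in> r" if "p \<in> P" "q \<in> P" for p q
  proof
    assume "(g p, g q) \<in> r'"
    then obtain p' q' where "(p', q') \<in> r" "g p = g p'" "g q = g q'" by (auto simp: r'_def)
    moreover from this have "p' \<in> P" "q' \<in> P" using rP(1) by auto
    ultimately show "(p, q) \<in> r" using g that by (metis inj_onD)
  qed (force simp: r'_def)
  have compat: "compatible_in (g ` P) r' (g p) (g q) \<longleftrightarrow> compatible_in P r p q"
    if "p \<in> P" "q \<in> P" for p q
    using that by (auto simp: compatible_in_def r'_iff)
  have "refl_on (g ` P) r'"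
    using rP(2) r'_iff by (auto simp: refl_on_def)
  moreover have "trans r'"
  proof (rule transI)
    fix x y z assume "(x, y) \<in> r'" "(y, z) \<in> r'"
    from \<open>(x, y) \<in> r'\<close> obtain p q where xy: "x = g p" "y = g q" "(p, q) \<in> r" by (auto simp: r'_def)
    from \<open>(y, z) \<in> r'\<close> obtain q' t where yz: "y = g q'" "z = g t" "(q', t) \<in> r" by (auto simp: r'_def)
    from xy yz have "q = q'" using g rP(1) by (metis inj_onD mem_Sigma_iff subsetD)
    with xy yz rP(3) have "(p, t) \<in> r" by (meson transD)
    with xy yz show "(x, z) \<in> r'" by (force simp: r'_def)
  qed
  ultimately have pre: "preorder_on (g ` P) r'"
    using rP(1) by (auto simp: preorder_on_def r'_def)
  have ccc: "ccc_on (g ` P) r'"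
    unfolding ccc_on_def
  proof (intro allI impI)
    fix A assume A: "A \<subseteq> g ` P" "pairwise (\<lambda>p q. \<not> compatible_in (g ` P) r' p q) A"
    then obtain B where B: "B \<subseteq> P" "A = g ` B" by (meson subset_imageE)
    have "pairwise (\<lambda>p q. \<not> compatible_in P r p q) B"
      unfolding pairwise_def
    proof (intro ballI impI)
      fix p q assume pq: "p \<in> B" "q \<in> B" "p \<noteq> q"
      then have "g p \<noteq> g q" using B(1) g by (meson inj_onD subsetD)
      with pq have "\<not> compatible_in (g ` P) r' (g p) (g q)"
        using A(2) B(2) by (simp add: pairwise_def)
      with pq B(1) compat show "\<not> compatible_in P r p q" by blast
    qed
    with r(2) B(1) have "countable B" by (auto simp: ccc_on_def)
    with B(2) show "countable A" by simp
  qed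
  have "|(`) g ` \<D>| \<le>o omega1" by (rule image_ordLeq_omega1[OF \<D>(1)])
  moreover have "dense_in_poset (g ` P) r' (g ` D)" if "D \<in> \<D>" for D
  proof -
    have "\<exists>d\<in>g ` D. (d, g p) \<in> r'" if p: "p \<in> P" for p
    proof -
      obtain d where "d \<in> D" "(d, p) \<in> r"
        using \<D>(2)[OF \<open>D \<in> \<D>\<close>] p unfolding dense_in_poset_def by blast
      then show ?thesis by (force simp: r'_def)
    qed
    moreover have "g ` D \<subseteq> g ` P"
      using \<D>(2)[OF that] by (simp add: dense_in_poset_def image_mono)
    ultimately show ?thesis by (simp add: dense_in_poset_def)
  qed
  ultimately have "\<exists>G. poset_filter (g ` P) r' G \<and> (\<forall>D\<in>(`) g ` \<D>. G \<inter> D \<noteq> {})"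
    by (intro MA[unfolded MA_omega1_def, THEN spec, THEN spec, THEN spec, THEN mp] conjI pre ccc)
      (use P(1) in simp_all)
  then obtain G where G: "poset_filter (g ` P) r' G" "\<And>D. D \<in> \<D> \<Longrightarrow> G \<inter> g ` D \<noteq> {}"
    by auto
  \<comment> \<open>The filter consists of images of points of \<open>P\<close>; by injectivity of
    \<open>g\<close> it pulls back to a filter.\<close>
  obtain F where F: "F \<subseteq> P" "G = g ` F"
    using G(1) unfolding poset_filter_def by (meson subset_imageE)
  have in_F: "p \<in> F" if "p \<in> P" "g p \<in> G" for p
    using that F g by (auto simp: inj_on_def)
  have "poset_filter P r F"
    unfolding poset_filter_def
  proof (intro conjI ballI impI)
    show "F \<noteq> {}" using G(1) F by (auto simp: poset_filter_def)
    show "q \<in> F" if "p \<in> F" "q \<in> P" "(p, q) \<in> r" for p q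
    proof (rule in_F)
      have "(g p, g q) \<in> r'" using that F(1) r'_iff by blast
      then show "g q \<in> G" using G(1) F that by (auto simp: poset_filter_def)
    qed (use that in simp)
    show "\<exists>s\<in>F. (s, p) \<in> r \<and> (s, q) \<in> r" if pq: "p \<in> F" "q \<in> F" for p q
    proof -
      have "\<exists>s\<in>G. (s, g p) \<in> r' \<and> (s, g q) \<in> r'"
        using G(1) pq F(2) by (simp add: poset_filter_def)
      then obtain s where s: "s \<in> F" "(g s, g p) \<in> r'" "(g s, g q) \<in> r'" unfolding F(2) by auto
      then have "s \<in> P" "p \<in> P" "q \<in> P" using pq F(1) by blast+
      with s show ?thesis using r'_iff[of s p] r'_iff[of s q] by blast
    qed
  qed (use F in simp)
  moreover have "F \<inter> D \<noteq> {}" if D: "D \<in> \<D>" for D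
  proof -
    obtain d where "d \<in> D" "g d \<in> G" using G(2)[OF D] by blast
    moreover from this have "d \<in> P" using \<D>(2)[OF D] by (auto simp: dense_in_poset_def)
    ultimately show ?thesis using in_F by blast
  qed
  ultimately show thesis using that by blast
qed

lemma ccc_cliquesD:
  assumes "ccc_cliques X H" "\<A> \<subseteq> finite_cliques X H" "uncountable \<A>"
  obtains p q where "p \<in> \<A>" "q \<in> \<A>" "p \<noteq> q" "pairwise H (p \<union> q)"
  using assms unfolding ccc_cliques_def by meson

text \<open>The poset consists of the finite cliques extending \<open>p0\<close>, larger cliques
  being stronger, so density is asked only there. The union of the filter is a clique because any
  two of its points lie in one condition.\<close>

lemma MA_cliques:
  assumes "MA_omega1" and X: "|X| \<le>o omega1" and ccc: "ccc_cliques X H"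
    and p0: "p0 \<in> finite_cliques X H" and \<D>: "|\<D>| \<le>o omega1"
    and dense: "\<And>D p. \<lbrakk>D \<in> \<D>; p \<in> finite_cliques X H; p0 \<subseteq> p\<rbrakk> \<Longrightarrow>
      \<exists>d\<in>D. d \<in> finite_cliques X H \<and> p \<subseteq> d"
  obtains G where "G \<subseteq> X" "pairwise H G" "\<forall>D\<in>\<D>. \<exists>d\<in>D. d \<subseteq> G"
proof -
  define P where "P = {p \<in> finite_cliques X H. p0 \<subseteq> p}"
  define r where "r = {(p, q). p \<in> P \<and> q \<in> P \<and> q \<subseteq> p}"
  have "P \<noteq> {}" using p0 by (auto simp: P_def)
  moreover have "|P| \<le>o omega1"
    using subset_ordLeq_omega1[OF _ Fpow_ordLeq_omega1[OF X]]
    by (auto simp: P_def finite_cliques_def)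
  moreover have "preorder_on P r"
    by (auto simp: preorder_on_def refl_on_def trans_def r_def)
  moreover have "ccc_on P r"
    unfolding ccc_on_def
  proof (intro allI impI, rule ccontr)
    fix A assume A: "A \<subseteq> P" "pairwise (\<lambda>p q. \<not> compatible_in P r p q) A" "uncountable A"
    then have "A \<subseteq> finite_cliques X H" by (auto simp: P_def)
    from ccc this A(3) obtain p q where pq: "p \<in> A" "q \<in> A" "p \<noteq> q" "pairwise H (p \<union> q)"
      by (rule ccc_cliquesD)
    with A(1) have "p \<in> P" "q \<in> P" by auto
    with pq(4) have "p \<union> q \<in> P" by (auto simp: P_def finite_cliques_def Fpow_def)
    with \<open>p \<in> P\<close> \<open>q \<in> P\<close> have "compatible_in P r p q"
      unfolding compatible_in_def r_def by blast
    with A(2) pq(1-3) show False by (simp add: pairwise_def)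
  qed
  moreover have "|(\<inter>) P ` \<D>| \<le>o omega1" by (rule image_ordLeq_omega1[OF \<D>])
  moreover have "dense_in_poset P r D'" if "D' \<in> (\<inter>) P ` \<D>" for D'
  proof -
    from that obtain D where D: "D \<in> \<D>" "D' = P \<inter> D" by blast
    have "\<exists>d\<in>D'. (d, p) \<in> r" if p: "p \<in> P" for p
    proof -
      obtain d where "d \<in> D" "d \<in> finite_cliques X H" "p \<subseteq> d"
        using dense[OF D(1)] p unfolding P_def by blast
      with p D(2) show ?thesis by (auto simp: P_def r_def)
    qed
    with D(2) show ?thesis by (auto simp: dense_in_poset_def)
  qed
  ultimately obtain F where F: "poset_filter P r F" "\<forall>D\<in>(\<inter>) P ` \<D>. F \<inter> D \<noteq> {}"
    by (rule MA_omega1_transport[OF \<open>MA_omega1\<close>])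
  have FP: "F \<subseteq> P" using F(1) by (simp add: poset_filter_def)
  have "\<Union>F \<subseteq> X" using FP by (auto simp: P_def finite_cliques_def Fpow_def)
  moreover have "pairwise H (\<Union>F)"
  proof (rule pairwiseI)
    fix a b assume "a \<in> \<Union>F" "b \<in> \<Union>F" "a \<noteq> b"
    then obtain p q where pq: "p \<in> F" "a \<in> p" "q \<in> F" "b \<in> q" by blast
    then obtain s where s: "s \<in> F" "(s, p) \<in> r" "(s, q) \<in> r"
      using F(1) unfolding poset_filter_def by blast
    then have "pairwise H s" using FP by (auto simp: P_def finite_cliques_def)
    moreover have "a \<in> s" "b \<in> s" using s pq by (auto simp: r_def)
    ultimately show "H a b" using \<open>a \<noteq> b\<close> by (simp add: pairwise_def)
  qed
  moreover have "\<forall>D\<in>\<D>. \<exists>d\<in>D. d \<subseteq> \<Union>F"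
  proof
    fix D assume "D \<in> \<D>"
    then have "F \<inter> (P \<inter> D) \<noteq> {}" using F(2) by simp
    then obtain d where "d \<in> F" "d \<in> D" by auto
    then show "\<exists>d\<in>D. d \<subseteq> \<Union>F" by (intro bexI[of _ d] Union_upper)
  qed
  ultimately show thesis by (rule that)
qed

section \<open>Uncountable cliques\<close>

lemma ccc_cliques_mono:
  assumes "ccc_cliques X H" "Y \<subseteq> X"
  shows "ccc_cliques Y H"
proof -
  have "finite_cliques Y H \<subseteq> finite_cliques X H"
    using assms(2) by (auto simp: finite_cliques_def Fpow_def)
  then show ?thesis using assms(1) unfolding ccc_cliques_def by (meson order_trans)
qed

text \<open>If every finite clique had an extension compatible with only countably many points, then
  such extensions of the singletons would contain an uncountable antichain. So below some finite
  clique the generic clique is unbounded in a well-order of type \<open>\<omega>\<^sub>1\<close>.\<close>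

lemma MA_uncountable_clique:
  assumes "MA_omega1" and "uncountable X" and "ccc_cliques X H"
  obtains Y where "Y \<subseteq> X" "uncountable Y" "pairwise H Y"
proof -
  obtain X0 where X0: "X0 \<subseteq> X" "|X0| =o omega1"
    using uncountable_obtain_omega1[OF assms(2)] .
  have unc: "uncountable X0" by (rule uncountable_if_ordIso_omega1[OF X0(2)])
  have ccc: "ccc_cliques X0 H" by (rule ccc_cliques_mono[OF assms(3) X0(1)])
  let ?FC = "finite_cliques X0 H"
  \<comment> \<open>The points that \<open>q\<close> has not yet excluded. That they are uncountably
    many for every \<open>q\<close> beyond \<open>p0\<close> is what makes the sets
    \<open>D a\<close> dense.\<close>
  define N where "N q = {a \<in> X0. \<exists>s\<in>?FC. q \<subseteq> s \<and> a \<in> s}" for q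
  have "\<exists>p0\<in>?FC. \<forall>q\<in>?FC. p0 \<subseteq> q \<longrightarrow> uncountable (N q)"
  proof (rule ccontr)
    assume neg: "\<not> ?thesis"
    have "\<exists>q. q \<in> ?FC \<and> a \<in> q \<and> countable (N q)" if "a \<in> X0" for a
    proof -
      have "{a} \<in> ?FC" using that by (auto simp: finite_cliques_def Fpow_def)
      with neg show ?thesis by blast
    qed
    then obtain Q where Q: "\<And>a. a \<in> X0 \<Longrightarrow> Q a \<in> ?FC \<and> a \<in> Q a \<and> countable (N (Q a))"
      by metis
    \<comment> \<open>If \<open>Q a\<close> and \<open>Q b\<close> are compatible, their union puts
      \<open>b\<close> into \<open>N (Q a)\<close>. So compatibility with \<open>Q a\<close> holds
      for countably many \<open>b\<close>, and an uncountable antichain results.\<close>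
    have "countable {b \<in> X0. pairwise H (Q a \<union> Q b)}" if a: "a \<in> X0" for a
    proof (rule countable_subset)
      show "{b \<in> X0. pairwise H (Q a \<union> Q b)} \<subseteq> N (Q a)"
      proof
        fix b assume b: "b \<in> {b \<in> X0. pairwise H (Q a \<union> Q b)}"
        then have "Q a \<union> Q b \<in> ?FC"
          using Q[OF a] Q[of b] by (auto simp: finite_cliques_def Fpow_def)
        then show "b \<in> N (Q a)" using b Q[of b] unfolding N_def by blast
      qed
      show "countable (N (Q a))" using Q[OF a] by blast
    qed
    moreover have "pairwise H (Q b \<union> Q a)" if "pairwise H (Q a \<union> Q b)" for a b
      using that by (simp add: Un_commute)
    ultimately obtain B where B: "B \<subseteq> X0" "uncountable B"
      "pairwise (\<lambda>a b. \<not> pairwise H (Q a \<union> Q b)) B"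
      by (rule uncountable_independent_subset[OF unc])
    have "inj_on Q B"
    proof (rule inj_onI, rule ccontr)
      fix a b assume ab: "a \<in> B" "b \<in> B" "Q a = Q b" "a \<noteq> b"
      then have "pairwise H (Q a \<union> Q b)"
        using Q[of a] B(1) by (auto simp: finite_cliques_def)
      with pairwiseD[OF B(3) ab(1,2,4)] show False by blast
    qed
    then have "uncountable (Q ` B)" using B(2) by (simp add: countable_image_inj_eq)
    moreover have "Q ` B \<subseteq> ?FC" using B(1) Q by blast
    ultimately obtain p q where pq: "p \<in> Q ` B" "q \<in> Q ` B" "p \<noteq> q" "pairwise H (p \<union> q)"
      using ccc_cliquesD[OF ccc, of "Q ` B"] by metis
    then obtain a b where "a \<in> B" "b \<in> B" "p = Q a" "q = Q b" by blast
    with pq(3,4) pairwiseD[OF B(3), of a b] show False by blast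
  qed
  then obtain p0 where p0: "p0 \<in> ?FC" "\<And>q. q \<in> ?FC \<Longrightarrow> p0 \<subseteq> q \<Longrightarrow> uncountable (N q)"
    by blast
  \<comment> \<open>The cardinal order on \<open>X0\<close> has type \<open>omega1\<close>, so its
    proper initial segments are countable.\<close>
  define U where "U = underS |X0|"
  have U: "countable (U a)" if "a \<in> X0" for a
  proof -
    have "|U a| <o |X0|"
      using card_of_underS[OF card_of_Card_order, of a X0] that by (simp add: U_def Field_card_of)
    then show ?thesis
      using X0(2) ordLess_ordIso_trans countable_iff_ordLess_omega1 by blast
  qed
  \<comment> \<open>Meeting all these sets makes the generic clique cofinal in \<open>X0\<close>,
    hence uncountable.\<close>
  define D where "D a = {d. \<exists>b\<in>d. b \<notin> U a}" for a
  have dense: "\<exists>d\<in>E. d \<in> ?FC \<and> p \<subseteq> d" if E: "E \<in> D ` X0" and p: "p \<in> ?FC" "p0 \<subseteq> p" for E p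
  proof -
    obtain a where a: "a \<in> X0" "E = D a" using E by blast
    have "\<not> N p \<subseteq> U a" using p0(2)[OF p] U[OF a(1)] countable_subset by blast
    then show ?thesis by (auto simp: N_def D_def a(2))
  qed
  have X0': "|X0| \<le>o omega1" using X0(2) ordIso_imp_ordLeq by blast
  from dense obtain G
    where G: "G \<subseteq> X0" "pairwise H G" "\<forall>E\<in>D ` X0. \<exists>d\<in>E. d \<subseteq> G"
    by (rule MA_cliques[OF assms(1) X0' ccc p0(1) image_ordLeq_omega1[OF X0', of D]])
  have X0_G: "X0 \<subseteq> (\<Union>b\<in>G. insert b (U b))"
  proof
    fix a assume a: "a \<in> X0"
    with G(3) obtain d where "d \<in> D a" "d \<subseteq> G" by auto
    then obtain b where b: "b \<in> G" "b \<notin> U a" unfolding D_def by auto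
    have "total_on X0 |X0|"
      using card_of_well_order_on[of X0] by (simp add: well_order_on_def linear_order_on_def)
    with a b G(1) have "a \<in> insert b (U b)"
      by (auto simp: U_def underS_def total_on_def)
    with b(1) show "a \<in> (\<Union>b\<in>G. insert b (U b))" by blast
  qed
  from unc have "uncountable G"
  proof (rule contrapos_nn)
    assume "countable G"
    then have "countable (\<Union>b\<in>G. insert b (U b))"
      using U G(1) by (intro countable_UN) auto
    with X0_G show "countable X0" by (rule countable_subset)
  qed
  with G X0(1) show thesis by (intro that[of G]) auto
qed

subsection \<open>Alike tuples\<close>

text \<open>The conditions of \<open>alike\<close> depend only on the pairs of entries at equal
  positions. As a property of the set of these pairs, alikeness passes to subsets, hence from
  concatenated tuples to their blocks.\<close>

definition alike_pairs :: "'a rel \<Rightarrow> ('a \<times> 'a) set \<Rightarrow> bool"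
  where "alike_pairs r Z \<longleftrightarrow> (\<forall>a b c d. (a, b) \<in> Z \<longrightarrow> (c, d) \<in> Z \<longrightarrow>
    ((a, b) \<in> r - Id \<longleftrightarrow> (c, d) \<in> r - Id) \<and>
    ((a, c) \<in> r - Id \<longleftrightarrow> (b, d) \<in> r - Id) \<and>
    (a \<noteq> c \<longrightarrow> ((a, c) \<in> r - Id \<longleftrightarrow> (a, d) \<in> r - Id) \<and> ((a, d) \<in> r - Id \<longleftrightarrow> (b, c) \<in> r - Id)))"

lemma alike_iff_pairs:
  assumes "length x = length y"
  shows "alike r x y \<longleftrightarrow> alike_pairs r (set (zip x y))"
proof
  assume "alike r x y"
  then show "alike_pairs r (set (zip x y))"
    unfolding alike_pairs_def set_zip alike_def by (clarsimp simp only: mem_Collect_eq prod.inject) auto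
next
  assume *: "alike_pairs r (set (zip x y))"
  have "(x ! i, y ! i) \<in> set (zip x y)" if "i < length x" for i
    using that assms by (auto simp: set_zip)
  with * show "alike r x y" unfolding alike_pairs_def alike_def by meson
qed

lemma alike_pairs_mono: "alike_pairs r Z \<Longrightarrow> W \<subseteq> Z \<Longrightarrow> alike_pairs r W"
  unfolding alike_pairs_def by (meson subsetD)

lemma alike_pairsD:
  assumes "alike_pairs r Z" "(a, b) \<in> Z" "(c, d) \<in> Z"
  shows "(a, b) \<in> r - Id \<longleftrightarrow> (c, d) \<in> r - Id"
    and "(a, c) \<in> r - Id \<longleftrightarrow> (b, d) \<in> r - Id"
    and "a \<noteq> c \<Longrightarrow> (a, c) \<in> r - Id \<longleftrightarrow> (a, d) \<in> r - Id"
    and "a \<noteq> c \<Longrightarrow> (a, d) \<in> r - Id \<longleftrightarrow> (b, c) \<in> r - Id"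
  using assms unfolding alike_pairs_def by meson+

lemma Linear_order_strict:
  assumes "Linear_order r"
  shows "(a, b) \<in> r - Id \<Longrightarrow> (b, a) \<notin> r - Id"
    and "a \<in> Field r \<Longrightarrow> b \<in> Field r \<Longrightarrow> a \<noteq> b \<Longrightarrow> (a, b) \<notin> r - Id \<Longrightarrow> (b, a) \<in> r - Id"
    and "(a, b) \<in> r - Id \<Longrightarrow> (b, c) \<in> r - Id \<Longrightarrow> (a, c) \<in> r - Id"
  using assms
  by (auto simp: linear_order_on_def partial_order_on_def preorder_on_def total_on_def
      dest: antisymD transD)

text \<open>Disjointness and totality reverse the direction of movement, and by the second clause
  distinct entries of \<open>y\<close> come from distinct entries of \<open>x\<close>. The remaining
  equivalences are those of \<open>alike r x y\<close>, chained in another order.\<close>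

lemma alike_sym:
  assumes r: "Linear_order r" and len: "length x = length y"
    and Field: "set x \<subseteq> Field r" "set y \<subseteq> Field r" and disj: "set x \<inter> set y = {}"
    and "alike r x y"
  shows "alike r y x"
proof -
  have Z: "alike_pairs r (set (zip x y))"
    using \<open>alike r x y\<close> len by (simp add: alike_iff_pairs)
  have "alike_pairs r (set (zip y x))"
    unfolding alike_pairs_def
  proof (intro allI impI)
    fix b a d c assume "(b, a) \<in> set (zip y x)" "(d, c) \<in> set (zip y x)"
    then have in_zip: "(a, b) \<in> set (zip x y)" "(c, d) \<in> set (zip x y)"
      using len by (auto simp: in_set_zip)
    then have mem: "a \<in> set x" "b \<in> set y" "c \<in> set x" "d \<in> set y"
      by (auto dest: set_zip_leftD set_zip_rightD)
    then have "a \<noteq> b" "c \<noteq> d" using disj by auto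
    have F: "a \<in> Field r" "b \<in> Field r" "c \<in> Field r" "d \<in> Field r" using mem Field by auto
    note lin = Linear_order_strict(1,2)[OF r]
    note D = alike_pairsD[OF Z in_zip] alike_pairsD[OF Z in_zip(2,1)]
    have "a \<noteq> c" if "b \<noteq> d"
      using that D(2,6) lin F by blast
    moreover have "(b, a) \<in> r - Id \<longleftrightarrow> (d, c) \<in> r - Id"
      using D(1) lin F \<open>a \<noteq> b\<close> \<open>c \<noteq> d\<close> by meson
    ultimately show "((b, a) \<in> r - Id \<longleftrightarrow> (d, c) \<in> r - Id) \<and>
      ((b, d) \<in> r - Id \<longleftrightarrow> (a, c) \<in> r - Id) \<and>
      (b \<noteq> d \<longrightarrow> ((b, d) \<in> r - Id \<longleftrightarrow> (b, c) \<in> r - Id) \<and> ((b, c) \<in> r - Id \<longleftrightarrow> (a, d) \<in> r - Id))"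
      using D(2,3,4) by meson
  qed
  then show ?thesis using len by (simp add: alike_iff_pairs)
qed

text \<open>Moving from \<open>w\<close> to \<open>v\<close> along pairs of \<open>Z\<close> jumps
  over no entry of \<open>u\<close>, because entries of \<open>u\<close> differ from those of
  \<open>w\<close> and are first coordinates of pairs in \<open>Z\<close>; \<open>u'\<close>
  supplies these pairs. So every comparison of \<open>u\<close> with \<open>w\<close> survives as
  one of \<open>u\<close> with \<open>v\<close>.\<close>

lemma alike_trans_pairs:
  assumes len: "length u = k" "length w = k" "length u' = k" "length v = k"
    and uw: "alike r u w" "set u \<inter> set w = {}"
    and Z: "alike_pairs r Z" "set (zip u u') \<subseteq> Z" "set (zip w v) \<subseteq> Z"
  shows "alike r u v"
  unfolding alike_def
proof (intro allI impI)
  fix i j assume "i < length u" "j < length u"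
  then have ij: "i < k" "j < k" using len by auto
  have u: "(u ! h, u' ! h) \<in> Z" and w: "(w ! h, v ! h) \<in> Z" if "h < k" for h
    using that len Z(2,3) by (auto simp: set_zip)
  have A: "(u ! i, w ! i) \<in> r - Id \<longleftrightarrow> (u ! j, w ! j) \<in> r - Id"
      "(u ! i, u ! j) \<in> r - Id \<longleftrightarrow> (w ! i, w ! j) \<in> r - Id"
      "u ! i \<noteq> u ! j \<longrightarrow> ((u ! i, u ! j) \<in> r - Id \<longleftrightarrow> (u ! i, w ! j) \<in> r - Id) \<and>
        ((u ! i, w ! j) \<in> r - Id \<longleftrightarrow> (w ! i, u ! j) \<in> r - Id)"
    using uw(1) ij len(1) unfolding alike_def by meson+
  have ne: "u ! h \<noteq> w ! h'" if "h < k" "h' < k" for h h'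
    using uw(2) len that by (metis disjoint_iff nth_mem)
  have uwv: "(u ! h, w ! h') \<in> r - Id \<longleftrightarrow> (u ! h, v ! h') \<in> r - Id" if "h < k" "h' < k" for h h'
    using alike_pairsD(3)[OF Z(1) u w] ne that by blast
  have wuv: "(w ! i, u ! j) \<in> r - Id \<longleftrightarrow> (v ! i, u ! j) \<in> r - Id"
    using alike_pairsD(3,4)[OF Z(1) w[OF ij(1)] u[OF ij(2)]] ne[OF ij(2,1)] by metis
  have "(w ! i, w ! j) \<in> r - Id \<longleftrightarrow> (v ! i, v ! j) \<in> r - Id"
    by (rule alike_pairsD(2)[OF Z(1) w[OF ij(1)] w[OF ij(2)]])
  with A uwv[OF ij(1,1)] uwv[OF ij(2,2)] uwv[OF ij] wuv
  show "((u ! i, v ! i) \<in> r - Id \<longleftrightarrow> (u ! j, v ! j) \<in> r - Id) \<and>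
     ((u ! i, u ! j) \<in> r - Id \<longleftrightarrow> (v ! i, v ! j) \<in> r - Id) \<and>
     (u ! i \<noteq> u ! j \<longrightarrow> ((u ! i, u ! j) \<in> r - Id \<longleftrightarrow> (u ! i, v ! j) \<in> r - Id) \<and>
       ((u ! i, v ! j) \<in> r - Id \<longleftrightarrow> (v ! i, u ! j) \<in> r - Id))"
    by meson
qed

text \<open>The common block length \<open>k\<close> keeps the concatenations aligned, so blocks at
  equal positions of \<open>l\<close> and \<open>l'\<close> are zipped with each other.\<close>

lemma set_zip_concat_map:
  assumes "length l = length l'" "(i, j) \<in> set (zip l l')"
    and "\<And>i. i \<in> set l \<union> set l' \<Longrightarrow> length (t i) = k"
  shows "set (zip (t i) (t j)) \<subseteq> set (zip (concat (map t l)) (concat (map t l')))"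
  using assms
proof (induction l l' rule: list_induct2)
  case (Cons x xs y ys)
  then have "length (t x) = length (t y)" by simp
  with Cons show ?case by (auto simp: zip_append)
qed simp

lemma length_concat_map:
  "(\<And>i. i \<in> set l \<Longrightarrow> length (t i) = k) \<Longrightarrow> length (concat (map t l)) = length l * k"
  by (induction l) auto

section \<open>The chain condition from rectangularity\<close>

lemma uncountable_obtain_two:
  assumes "uncountable A"
  obtains i j where "i \<in> A" "j \<in> A" "i \<noteq> j"
  by (metis assms countable_empty countable_insert ex_in_conv insertCI subsetI subset_singletonD)

text \<open>An index set of size \<open>omega1\<close> gives a family as in the definition once
  \<open>t\<close> is injective on it. Disjointness ensures this for nonempty tuples; empty tuples
  coincide, but any two of them are alike.\<close>

lemma rectangular_order_alike:
  assumes r: "rectangular_order r" and I: "uncountable I"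
    and t: "\<And>i. i \<in> I \<Longrightarrow> length (t i) = n \<and> set (t i) \<subseteq> Field r"
    and disj: "pairwise (\<lambda>i j. set (t i) \<inter> set (t j) = {}) I"
  obtains i j where "i \<in> I" "j \<in> I" "i \<noteq> j" "alike r (t i) (t j)"
proof (cases "n = 0")
  case True
  obtain i j where ij: "i \<in> I" "j \<in> I" "i \<noteq> j"
    by (rule uncountable_obtain_two[OF I])
  moreover have "alike r (t i) (t j)" using t[OF ij(1)] True by (simp add: alike_def)
  ultimately show thesis by (rule that)
next
  case False
  obtain J where J: "J \<subseteq> I" "|J| =o omega1" by (rule uncountable_obtain_omega1[OF I])
  have inj: "inj_on t J"
  proof (rule inj_onI, rule ccontr)
    fix i j assume ij: "i \<in> J" "j \<in> J" "t i = t j" "i \<noteq> j"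
    then have "set (t i) \<inter> set (t j) = {}" using pairwiseD[OF disj, of i j] J(1) by blast
    with ij have "t i = []" by simp
    then show False using t[of i] ij J(1) False by auto
  qed
  have "|t ` J| =o omega1"
    using inj J(2) by (meson card_of_ordIsoI inj_on_imp_bij_betw ordIso_symmetric ordIso_transitive)
  moreover have "t ` J \<subseteq> {x. length x = n \<and> set x \<subseteq> Field r}" using t J(1) by blast
  moreover have "pairwise (\<lambda>x y. set x \<inter> set y = {}) (t ` J)"
  proof (rule pairwiseI)
    fix x y assume "x \<in> t ` J" "y \<in> t ` J" "x \<noteq> y"
    then obtain i j where ij: "i \<in> J" "j \<in> J" "x = t i" "y = t j" "i \<noteq> j" by blast
    then have "i \<in> I" "j \<in> I" using J(1) by auto
    from pairwiseD[OF disj this ij(5)] ij(3,4) show "set x \<inter> set y = {}" by simp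
  qed
  ultimately obtain x y where "x \<in> t ` J" "y \<in> t ` J" "x \<noteq> y" "alike r x y"
    using r unfolding rectangular_order_def by meson
  then show thesis using that J(1) by blast
qed

text \<open>Concatenating the tuples of a clique makes one long tuple, to which rectangularity
  applies. If \<open>T l\<close> and \<open>T l'\<close> are alike, each tuple of \<open>l\<close>
  moves to its counterpart in \<open>l'\<close> without jumping, and alikeness inside
  \<open>l\<close> then links arbitrary members of the two cliques.\<close>

lemma ccc_cliques_alike:
  assumes r: "Linear_order r" "rectangular_order r"
    and t: "\<And>i. i \<in> X \<Longrightarrow> length (t i) = k \<and> set (t i) \<subseteq> Field r"
    and disj: "pairwise (\<lambda>i j. set (t i) \<inter> set (t j) = {}) X"
  shows "ccc_cliques X (\<lambda>i j. alike r (t i) (t j))"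
proof (rule ccc_cliquesI)
  let ?H = "\<lambda>i j. alike r (t i) (t j)"
  fix n and \<Lambda> :: "'b list set"
  assume unc: "uncountable \<Lambda>"
    and \<Lambda>: "\<And>l. l \<in> \<Lambda> \<Longrightarrow> length l = n \<and> set l \<in> finite_cliques X ?H"
    and \<Lambda>_disj: "pairwise (\<lambda>l l'. set l \<inter> set l' = {}) \<Lambda>"
  have X: "set l \<subseteq> X" if "l \<in> \<Lambda>" for l
    using \<Lambda>[OF that] by (auto simp: finite_cliques_def Fpow_def)
  have tl: "length (t i) = k" if "l \<in> \<Lambda>" "i \<in> set l" for l i
    using X[OF that(1)] that(2) t by blast
  define T where "T l = concat (map t l)" for l
  have "length (T l) = n * k \<and> set (T l) \<subseteq> Field r" if "l \<in> \<Lambda>" for l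
  proof
    show "length (T l) = n * k"
      using length_concat_map[of l t k] tl[OF that] \<Lambda>[OF that] by (simp add: T_def)
    show "set (T l) \<subseteq> Field r" using X[OF that] t by (fastforce simp: T_def)
  qed
  moreover have "pairwise (\<lambda>l l'. set (T l) \<inter> set (T l') = {}) \<Lambda>"
  proof (rule pairwiseI)
    fix l l' assume l: "l \<in> \<Lambda>" "l' \<in> \<Lambda>" "l \<noteq> l'"
    have "set (t i) \<inter> set (t j) = {}" if "i \<in> set l" "j \<in> set l'" for i j
    proof (rule pairwiseD[OF disj])
      show "i \<in> X" "j \<in> X" using X[OF l(1)] X[OF l(2)] that by auto
      show "i \<noteq> j" using pairwiseD[OF \<Lambda>_disj l] that by blast
    qed
    then show "set (T l) \<inter> set (T l') = {}" by (auto simp: T_def)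
  qed
  ultimately obtain l l' where l: "l \<in> \<Lambda>" "l' \<in> \<Lambda>" "l \<noteq> l'" "alike r (T l) (T l')"
    by (rule rectangular_order_alike[OF r(2) unc])
  have len: "length l = n" "length l' = n" using \<Lambda> l by auto
  have cl: "pairwise ?H (set l)" "pairwise ?H (set l')"
    using \<Lambda>[OF l(1)] \<Lambda>[OF l(2)] by (auto simp: finite_cliques_def)
  have lenT: "length (T l) = length (T l')"
    using length_concat_map[of l t k] length_concat_map[of l' t k] tl l(1,2) len
    by (simp add: T_def)
  define Z where "Z = set (zip (T l) (T l'))"
  have Z: "alike_pairs r Z" using l(4) lenT by (simp add: Z_def alike_iff_pairs)
  have zip_Z: "set (zip (t i) (t j)) \<subseteq> Z" if "(i, j) \<in> set (zip l l')" for i j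
    unfolding Z_def T_def using that
    by (rule set_zip_concat_map[of _ _ _ _ _ k, rotated]) (use len tl l in auto)
  \<comment> \<open>The bridge is \<open>l ! b\<close>, the counterpart of \<open>j\<close> in
    \<open>l\<close>. If it is \<open>i\<close>, the blocks are already paired in \<open>Z\<close>;
    otherwise \<open>t i\<close> is alike to \<open>t (l ! b)\<close>, which
    \<open>alike_trans_pairs\<close> replaces by \<open>t j\<close>.\<close>
  have cross: "?H i j" if ij: "i \<in> set l" "j \<in> set l'" for i j
  proof -
    obtain a b where ab: "a < n" "i = l ! a" "b < n" "j = l' ! b"
      using ij len by (metis in_set_conv_nth)
    have zip_ab: "(i, l' ! a) \<in> set (zip l l')" "(l ! b, j) \<in> set (zip l l')"
      using ab len by (auto simp: set_zip)
    have mem: "l ! b \<in> set l" "l' ! a \<in> set l'" using ab len by auto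
    note tlen = tl[OF l(1) ij(1)] tl[OF l(1) mem(1)] tl[OF l(2) mem(2)] tl[OF l(2) ij(2)]
    show ?thesis
    proof (cases "l ! b = i")
      case True
      then have "alike_pairs r (set (zip (t i) (t j)))"
        using alike_pairs_mono[OF Z] zip_Z zip_ab(2) by blast
      then show ?thesis using tlen by (simp add: alike_iff_pairs)
    next
      case False
      then have "?H i (l ! b)" using cl(1) ij(1) mem(1) by (metis pairwiseD)
      moreover have "i \<in> X" "l ! b \<in> X" using X[OF l(1)] ij(1) mem(1) by auto
      then have "set (t i) \<inter> set (t (l ! b)) = {}"
        using pairwiseD[OF disj] False by blast
      ultimately show ?thesis
        by (rule alike_trans_pairs[OF tlen _ _ Z zip_Z[OF zip_ab(1)] zip_Z[OF zip_ab(2)]])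
    qed
  qed
  have cross': "?H j i" if ij: "i \<in> set l" "j \<in> set l'" for i j
  proof (rule alike_sym[OF r(1) _ _ _ _ cross[OF ij]])
    have ij_X: "i \<in> X" "j \<in> X" using X l(1,2) ij by auto
    have "i \<noteq> j" using ij pairwiseD[OF \<Lambda>_disj l(1-3)] by blast
    from t[OF ij_X(1)] t[OF ij_X(2)] pairwiseD[OF disj ij_X this] show "length (t i) = length (t j)" "set (t i) \<subseteq> Field r" "set (t j) \<subseteq> Field r"
      "set (t i) \<inter> set (t j) = {}"
      by simp_all
  qed
  have "pairwise ?H (set l \<union> set l')"
  proof (rule pairwiseI)
    fix i j assume "i \<in> set l \<union> set l'" "j \<in> set l \<union> set l'" "i \<noteq> j"
    then show "?H i j" using pairwiseD[OF cl(1)] pairwiseD[OF cl(2)] cross cross' by blast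
  qed
  with l show "\<exists>l\<in>\<Lambda>. \<exists>l'\<in>\<Lambda>. l \<noteq> l' \<and> pairwise ?H (set l \<union> set l')" by blast
qed

lemma MA_uncountable_alike:
  assumes "MA_omega1" and r: "Linear_order r" "rectangular_order r" and "uncountable X"
    and t: "\<And>i. i \<in> X \<Longrightarrow> length (t i) = k \<and> set (t i) \<subseteq> Field r"
    and disj: "pairwise (\<lambda>i j. set (t i) \<inter> set (t j) = {}) X"
  obtains Y where "Y \<subseteq> X" "uncountable Y" "pairwise (\<lambda>i j. alike r (t i) (t j)) Y"
proof -
  have "ccc_cliques X (\<lambda>i j. alike r (t i) (t j))" by (rule ccc_cliques_alike[OF r t disj])
  with that show thesis by (rule MA_uncountable_clique[OF assms(1,4), rotated])
qed

section \<open>From an isomorphism to the absence of a common suborder\<close>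

lemma not_common_suborder_if_iso:
  assumes K: "Linear_order K" and L: "Linear_order L" "rectangular_order L"
    and "order_isomorphic K L"
  shows "\<not> common_uncountable_suborder K (L\<inverse>)"
proof
  assume "common_uncountable_suborder K (L\<inverse>)"
  then obtain M :: "'a rel" where M: "Linear_order M" "uncountable (Field M)"
    and embeds: "order_embeds M K" "order_embeds M (L\<inverse>)"
    unfolding common_uncountable_suborder_def by (elim exE conjE)
  from embeds(1) obtain f where f: "f ` Field M \<subseteq> Field K"
      "\<forall>x\<in>Field M. \<forall>y\<in>Field M. (x, y) \<in> M - Id \<longleftrightarrow> (f x, f y) \<in> K - Id"
    unfolding order_embeds_def by (elim exE conjE)
  from embeds(2) obtain g where g: "g ` Field M \<subseteq> Field L"
      "\<forall>x\<in>Field M. \<forall>y\<in>Field M. (x, y) \<in> M - Id \<longleftrightarrow> (g x, g y) \<in> L\<inverse> - Id"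
    unfolding order_embeds_def Field_converse by (elim exE conjE)
  obtain \<phi> where "iso K L \<phi>" using assms(4) by (auto simp: order_isomorphic_def)
  then have \<phi>: "bij_betw \<phi> (Field K) (Field L)"
    "\<And>a b. a \<in> Field K \<Longrightarrow> b \<in> Field K \<Longrightarrow> (a, b) \<in> K \<longleftrightarrow> (\<phi> a, \<phi> b) \<in> L"
    by (auto simp: iso_iff2)
  \<comment> \<open>Both \<open>h\<close> and \<open>g\<close> inject the field of \<open>M\<close>
    into that of \<open>L\<close>, \<open>h\<close> increasing and \<open>g\<close>
    decreasing.\<close>
  define h where "h m = \<phi> (f m)" for m
  have h_in: "h m \<in> Field L" if "m \<in> Field M" for m
    using that f(1) \<phi>(1) by (auto simp: h_def bij_betw_def)
  have g_in: "g m \<in> Field L" if "m \<in> Field M" for m using that g(1) by auto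
  have h: "(h x, h y) \<in> L - Id" if "x \<in> Field M" "y \<in> Field M" "(x, y) \<in> M - Id" for x y
  proof -
    have "f x \<in> Field K" "f y \<in> Field K" "(f x, f y) \<in> K" "f x \<noteq> f y"
      using f that by auto
    moreover from this have "\<phi> (f x) \<noteq> \<phi> (f y)"
      using \<phi>(1) by (meson bij_betw_def inj_on_eq_iff)
    ultimately show ?thesis using \<phi>(2) by (simp add: h_def)
  qed
  have g': "(g y, g x) \<in> L - Id" if "x \<in> Field M" "y \<in> Field M" "(x, y) \<in> M - Id" for x y
    using g(2) that by auto
  have total: "(x, y) \<in> M - Id \<or> (y, x) \<in> M - Id" if "x \<in> Field M" "y \<in> Field M" "x \<noteq> y" for x y
    using Linear_order_strict(2)[OF M(1) that] by blast
  have "h x \<noteq> h y \<and> g x \<noteq> g y" if xy: "x \<in> Field M" "y \<in> Field M" "x \<noteq> y" for x y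
    using total[OF xy] h[OF xy(1,2)] h[OF xy(2,1)] g'[OF xy(1,2)] g'[OF xy(2,1)] by auto
  then have inj: "inj_on h (Field M)" "inj_on g (Field M)"
    by (meson inj_onI)+
  \<comment> \<open>By injectivity each point is an entry for at most two indices, so uncountably
    many disjoint pairs can be selected.\<close>
  let ?s = "\<lambda>m. {h m, g m}"
  have "countable {m \<in> Field M. e \<in> ?s m}" for e
  proof -
    have "{m \<in> Field M. e \<in> ?s m} = {m \<in> Field M. h m \<in> {e}} \<union> {m \<in> Field M. g m \<in> {e}}"
      by auto
    then show ?thesis
      using countable_image_inj_gen[OF inj(1), of "{e}"] countable_image_inj_gen[OF inj(2), of "{e}"]
      by simp
  qed
  then obtain B where B: "B \<subseteq> Field M" "uncountable B" "pairwise (\<lambda>i j. ?s i \<inter> ?s j = {}) B"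
    by (rule uncountable_avoiding_subfamily[OF M(2), of ?s ?s]) (simp, fast)
  define t where "t m = [h m, g m]" for m
  have "length (t m) = 2 \<and> set (t m) \<subseteq> Field L" if "m \<in> B" for m
    using that B(1) h_in g_in by (auto simp: t_def)
  moreover have "pairwise (\<lambda>i j. set (t i) \<inter> set (t j) = {}) B" using B(3) by (simp add: t_def)
  ultimately obtain i j where ij: "i \<in> B" "j \<in> B" "i \<noteq> j" "alike L (t i) (t j)"
    by (rule rectangular_order_alike[OF L(2) B(2)])
  \<comment> \<open>The first clause of \<open>alike\<close> for coordinates 0 and 1: both entries
    move in the same direction, against the opposite monotonicity of \<open>h\<close> and
    \<open>g\<close>.\<close>
  have iff: "(h i, h j) \<in> L - Id \<longleftrightarrow> (g i, g j) \<in> L - Id"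
    using ij(4)[unfolded alike_def, rule_format, of 0 1] by (simp add: t_def)
  have "i \<in> Field M" "j \<in> Field M" using ij B(1) by auto
  with total[OF this ij(3)] h[of i j] h[of j i] g'[of i j] g'[of j i] iff
    Linear_order_strict(1)[OF L(1), of "h i" "h j"] Linear_order_strict(1)[OF L(1), of "g i" "g j"]
  show False by blast
qed


subsection \<open>Increasing finite partial maps\<close>

text \<open>Taken in both directions over linear orders, the condition also makes first coordinates
  equal exactly when second coordinates are, so a clique is the graph of an increasing
  injection.\<close>

definition increasing_pair :: "'a rel \<Rightarrow> 'b rel \<Rightarrow> 'a \<times> 'b \<Rightarrow> 'a \<times> 'b \<Rightarrow> bool"
  where "increasing_pair K L e e' \<longleftrightarrow>
    ((fst e, fst e') \<in> K - Id \<longleftrightarrow> (snd e, snd e') \<in> L - Id)"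

text \<open>Otherwise sending \<open>x i\<close> to \<open>y i\<close> would reverse the order
  throughout, and the suborder of \<open>K\<close> on the image of \<open>x\<close> would embed into
  the converse of \<open>L\<close>.\<close>

lemma obtain_increasing_pair:
  assumes K: "Linear_order K" and L: "Linear_order L"
    and no_common: "\<not> common_uncountable_suborder K (L\<inverse>)" and "uncountable I"
    and xy: "\<And>i. i \<in> I \<Longrightarrow> x i \<in> Field K \<and> y i \<in> Field L"
    and inj: "inj_on x I" "inj_on y I"
  obtains i j where "i \<in> I" "j \<in> I" "i \<noteq> j" "(x i, x j) \<in> K - Id" "(y i, y j) \<in> L - Id"
proof (rule ccontr)
  assume "\<not> thesis"
  with that have none: "(y i, y j) \<notin> L - Id" if "i \<in> I" "j \<in> I" "(x i, x j) \<in> K - Id" for i j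
    using \<open>i \<in> I\<close> \<open>j \<in> I\<close> \<open>(x i, x j) \<in> K - Id\<close> by blast
  define M where "M = Restr K (x ` I)"
  have sub: "x ` I \<subseteq> Field K" using xy by blast
  have Field: "Field M = x ` I"
    unfolding M_def using K sub
    by (intro Refl_Field_Restr2)
      (auto simp: linear_order_on_def partial_order_on_def preorder_on_def)
  have M: "Linear_order M" unfolding M_def using K by (rule Linear_order_Restr)
  have unc: "uncountable (Field M)"
    using \<open>uncountable I\<close> inj(1) by (simp add: Field countable_image_inj_eq)
  have "order_embeds M K"
    unfolding order_embeds_def
    by (rule exI[of _ id]) (use sub Field in \<open>auto simp: M_def\<close>)
  moreover have "order_embeds M (L\<inverse>)"
    unfolding order_embeds_def
  proof (intro exI conjI ballI)
    let ?g = "\<lambda>a. y (inv_into I x a)"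
    have g: "?g (x i) = y i" if "i \<in> I" for i using inj(1) that by simp
    show "?g ` Field M \<subseteq> Field (L\<inverse>)" using xy g by (auto simp: Field)
    fix a b assume "a \<in> Field M" "b \<in> Field M"
    then obtain i j where ij: "i \<in> I" "j \<in> I" "a = x i" "b = x j" by (auto simp: Field)
    have "(x i, x j) \<in> K - Id \<longleftrightarrow> (y j, y i) \<in> L - Id"
    proof (cases "i = j")
      case False
      then have ne: "x i \<noteq> x j" "y i \<noteq> y j" using ij inj by (auto simp: inj_on_def)
      have mem: "x i \<in> Field K" "x j \<in> Field K" "y i \<in> Field L" "y j \<in> Field L" using ij xy by auto
      show ?thesis
        using none[OF ij(1,2)] none[OF ij(2,1)] Linear_order_strict(2)[OF K mem(1,2) ne(1)]
          Linear_order_strict(2)[OF L mem(3,4) ne(2)] by blast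
    qed simp
    then show "(a, b) \<in> M - Id \<longleftrightarrow> (?g a, ?g b) \<in> L\<inverse> - Id"
      using ij g by (auto simp: M_def)
  qed
  ultimately show False using no_common M unc unfolding common_uncountable_suborder_def by meson
qed

text \<open>Countable fibres allow thinning until distinct conditions share no coordinate. Once
  first and second coordinates are pairwise alike, a single position moving up in both orders forces
  every position to do so.\<close>

lemma ccc_cliques_increasing:
  fixes K :: "'a rel" and L :: "'b rel"
  assumes MA: "MA_omega1"
    and K: "Linear_order K" "rectangular_order K" and L: "Linear_order L" "rectangular_order L"
    and no_common: "\<not> common_uncountable_suborder K (L\<inverse>)"
    and E: "E \<subseteq> Field K \<times> Field L"
    and fibres: "\<And>x. countable {e \<in> E. fst e = x}" "\<And>y. countable {e \<in> E. snd e = y}"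
  shows "ccc_cliques E (increasing_pair K L)"
proof (rule ccc_cliquesI)
  let ?H = "increasing_pair K L"
  fix n and \<Lambda> :: "('a \<times> 'b) list set"
  assume unc: "uncountable \<Lambda>"
    and \<Lambda>: "\<And>l. l \<in> \<Lambda> \<Longrightarrow> length l = n \<and> set l \<in> finite_cliques E ?H"
    and \<Lambda>_disj: "pairwise (\<lambda>l l'. set l \<inter> set l' = {}) \<Lambda>"
  have \<Lambda>_E: "set l \<subseteq> E" if "l \<in> \<Lambda>" for l
    using \<Lambda>[OF that] by (auto simp: finite_cliques_def Fpow_def)
  \<comment> \<open>Conditions are later compared at position 0.\<close>
  have "n \<noteq> 0"
  proof
    assume "n = 0"
    then have "\<Lambda> \<subseteq> {[]}" using \<Lambda> by auto
    with unc show False by (meson countable_empty countable_insert countable_subset)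
  qed
  then have "0 < n" by simp
  \<comment> \<open>The pairs of \<open>E\<close> sharing a coordinate with \<open>l\<close>,
    countably many by \<open>fibres\<close>. Intersecting with \<open>E\<close> keeps the conflict
    relation symmetric for arbitrary lists, as \<open>uncountable_avoiding_subfamily\<close>
    asks.\<close>
  define C where "C l = {e \<in> E. \<exists>e'\<in>set l \<inter> E. fst e = fst e' \<or> snd e = snd e'}" for l
  have "countable {l \<in> \<Lambda>. e \<in> set l \<inter> E}" for e
  proof (cases "\<exists>l\<in>\<Lambda>. e \<in> set l")
    case True
    then obtain l where l: "l \<in> \<Lambda>" "e \<in> set l" by blast
    have "{l \<in> \<Lambda>. e \<in> set l \<inter> E} \<subseteq> {l}"
      using pairwiseD[OF \<Lambda>_disj l(1)] l(2) by blast
    then show ?thesis by (meson countable_empty countable_insert countable_subset)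
  next
    case False
    then have "{l \<in> \<Lambda>. e \<in> set l \<inter> E} = {}" by blast
    then show ?thesis by (simp only: countable_empty)
  qed
  moreover have "countable (C l)" for l
  proof -
    have "C l = (\<Union>e'\<in>set l \<inter> E. {e \<in> E. fst e = fst e'} \<union> {e \<in> E. snd e = snd e'})"
      by (auto simp: C_def)
    then show ?thesis using fibres by (simp add: countable_finite)
  qed
  moreover have "(set l' \<inter> E) \<inter> C l \<noteq> {}" if "(set l \<inter> E) \<inter> C l' \<noteq> {}" for l l'
  proof -
    from that obtain e e' where ee: "e \<in> set l \<inter> E" "e' \<in> set l' \<inter> E" "fst e = fst e' \<or> snd e = snd e'"
      unfolding C_def by blast
    then have "e' \<in> C l"
      unfolding C_def by (intro CollectI conjI bexI[of _ e]) auto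
    with ee show ?thesis by blast
  qed
  ultimately obtain \<Lambda>1 where \<Lambda>1: "\<Lambda>1 \<subseteq> \<Lambda>" "uncountable \<Lambda>1"
    "pairwise (\<lambda>l l'. (set l \<inter> E) \<inter> C l' = {}) \<Lambda>1"
    by (rule uncountable_avoiding_subfamily[OF unc])
  have ne: "fst e \<noteq> fst e' \<and> snd e \<noteq> snd e'"
    if l: "l \<in> \<Lambda>1" "l' \<in> \<Lambda>1" "l \<noteq> l'" and e: "e \<in> set l" "e' \<in> set l'" for l l' e e'
  proof -
    have "e \<in> E" "e' \<in> E" using \<Lambda>_E l e \<Lambda>1(1) by blast+
    with pairwiseD[OF \<Lambda>1(3) l] e show ?thesis unfolding C_def by blast
  qed
  have "length (map fst l) = n \<and> set (map fst l) \<subseteq> Field K" if "l \<in> \<Lambda>1" for l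
    using \<Lambda> \<Lambda>_E that \<Lambda>1(1) E by fastforce
  moreover have "pairwise (\<lambda>l l'. set (map fst l) \<inter> set (map fst l') = {}) \<Lambda>1"
    using ne by (force simp: pairwise_def)
  ultimately obtain \<Lambda>2 where \<Lambda>2: "\<Lambda>2 \<subseteq> \<Lambda>1" "uncountable \<Lambda>2"
    "pairwise (\<lambda>l l'. alike K (map fst l) (map fst l')) \<Lambda>2"
    by (rule MA_uncountable_alike[OF MA K \<Lambda>1(2)])
  have "length (map snd l) = n \<and> set (map snd l) \<subseteq> Field L" if "l \<in> \<Lambda>2" for l
    using \<Lambda> \<Lambda>_E that \<Lambda>1(1) \<Lambda>2(1) E by fastforce
  moreover have "pairwise (\<lambda>l l'. set (map snd l) \<inter> set (map snd l') = {}) \<Lambda>2"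
    using ne \<Lambda>2(1) by (force simp: pairwise_def)
  ultimately obtain \<Lambda>3 where \<Lambda>3: "\<Lambda>3 \<subseteq> \<Lambda>2" "uncountable \<Lambda>3"
    "pairwise (\<lambda>l l'. alike L (map snd l) (map snd l')) \<Lambda>3"
    by (rule MA_uncountable_alike[OF MA L \<Lambda>2(2)])
  have \<Lambda>3_sub: "\<Lambda>3 \<subseteq> \<Lambda>" using \<Lambda>1(1) \<Lambda>2(1) \<Lambda>3(1) by blast
  have len: "length l = n" if "l \<in> \<Lambda>3" for l using \<Lambda> that \<Lambda>3_sub by blast
  have nth_E: "l ! i \<in> E" if "l \<in> \<Lambda>3" "i < n" for l i
    using \<Lambda>_E[of l] nth_mem[of i l] len[OF that(1)] that \<Lambda>3_sub by blast
  have nth_F: "fst (l ! i) \<in> Field K" "snd (l ! i) \<in> Field L" if "l \<in> \<Lambda>3" "i < n" for l i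
    using nth_E[OF that] E by auto
  have nth_ne: "fst (l ! 0) \<noteq> fst (l' ! 0)" "snd (l ! 0) \<noteq> snd (l' ! 0)"
    if "l \<in> \<Lambda>3" "l' \<in> \<Lambda>3" "l \<noteq> l'" for l l'
  proof -
    have "l \<in> \<Lambda>1" "l' \<in> \<Lambda>1" using that \<Lambda>2(1) \<Lambda>3(1) by auto
    with ne[OF this that(3), of "l ! 0" "l' ! 0"] len that \<open>0 < n\<close>
    show "fst (l ! 0) \<noteq> fst (l' ! 0)" "snd (l ! 0) \<noteq> snd (l' ! 0)" by auto
  qed
  have "fst (l ! 0) \<in> Field K \<and> snd (l ! 0) \<in> Field L" if "l \<in> \<Lambda>3" for l
    using nth_F[OF that \<open>0 < n\<close>] by blast
  moreover have "inj_on (\<lambda>l. fst (l ! 0)) \<Lambda>3" "inj_on (\<lambda>l. snd (l ! 0)) \<Lambda>3"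
    unfolding inj_on_def using nth_ne by blast+
  \<comment> \<open>Here the absence of a common suborder enters: it yields two conditions whose
    entries at position 0 move upwards in both orders.\<close>
  ultimately obtain p q where pq: "p \<in> \<Lambda>3" "q \<in> \<Lambda>3" "p \<noteq> q"
    "(fst (p ! 0), fst (q ! 0)) \<in> K - Id" "(snd (p ! 0), snd (q ! 0)) \<in> L - Id"
    by (rule obtain_increasing_pair[OF K(1) L(1) no_common \<Lambda>3(2)])
  have pq_\<Lambda>: "p \<in> \<Lambda>" "q \<in> \<Lambda>" using pq \<Lambda>3_sub by auto
  then have cl: "pairwise ?H (set p)" "pairwise ?H (set q)"
    using \<Lambda> by (auto simp: finite_cliques_def)
  have len_pq: "length p = n" "length q = n" using len pq by auto
  have "p \<in> \<Lambda>2" "q \<in> \<Lambda>2" using pq \<Lambda>3(1) by auto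
  then have alike: "alike K (map fst p) (map fst q)" "alike L (map snd p) (map snd q)"
    using pairwiseD[OF \<Lambda>2(3)] pairwiseD[OF \<Lambda>3(3)] pq by auto
  have cross: "?H (p ! i) (q ! j) \<and> ?H (q ! j) (p ! i)" if ij: "i < n" "j < n" for i j
  proof -
    define x x' y y' where "x h = fst (p ! h)" and "x' h = fst (q ! h)"
      and "y h = snd (p ! h)" and "y' h = snd (q ! h)" for h
    note defs = x_def x'_def y_def y'_def
    have mem: "x i \<in> Field K" "x j \<in> Field K" "x' i \<in> Field K" "x' j \<in> Field K"
        "y i \<in> Field L" "y j \<in> Field L" "y' i \<in> Field L" "y' j \<in> Field L"
      using nth_F pq ij by (auto simp: defs)
    \<comment> \<open>By the first clause of \<open>alike\<close>, the upward move at position 0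
      spreads to every position.\<close>
    have up: "(x h, x' h) \<in> K - Id" "(y h, y' h) \<in> L - Id" if "h < n" for h
      using alike[unfolded alike_def, rule_format, of h 0] that \<open>0 < n\<close> len_pq pq(4,5)
      by (auto simp: defs)
    have aK: "(x i, x j) \<in> K - Id \<longleftrightarrow> (x' i, x' j) \<in> K - Id" "(x j, x i) \<in> K - Id \<longleftrightarrow> (x' j, x' i) \<in> K - Id"
        "x i \<noteq> x j \<Longrightarrow> (x i, x j) \<in> K - Id \<longleftrightarrow> (x i, x' j) \<in> K - Id"
        "x i \<noteq> x j \<Longrightarrow> (x j, x i) \<in> K - Id \<longleftrightarrow> (x' j, x i) \<in> K - Id"
      using alike(1)[unfolded alike_def, rule_format, of i j]
        alike(1)[unfolded alike_def, rule_format, of j i] ij len_pq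
      by (auto simp: defs)
    have aL: "(y i, y j) \<in> L - Id \<longleftrightarrow> (y' i, y' j) \<in> L - Id" "(y j, y i) \<in> L - Id \<longleftrightarrow> (y' j, y' i) \<in> L - Id"
        "y i \<noteq> y j \<Longrightarrow> (y i, y j) \<in> L - Id \<longleftrightarrow> (y i, y' j) \<in> L - Id"
        "y i \<noteq> y j \<Longrightarrow> (y j, y i) \<in> L - Id \<longleftrightarrow> (y' j, y i) \<in> L - Id"
      using alike(2)[unfolded alike_def, rule_format, of i j]
        alike(2)[unfolded alike_def, rule_format, of j i] ij len_pq
      by (auto simp: defs)
    have inc: "(x i, x j) \<in> K - Id \<longleftrightarrow> (y i, y j) \<in> L - Id" "(x j, x i) \<in> K - Id \<longleftrightarrow> (y j, y i) \<in> L - Id"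
    proof -
      have "p ! i \<in> set p" "p ! j \<in> set p" using ij len_pq by auto
      then have "p ! i = p ! j \<or> ?H (p ! i) (p ! j) \<and> ?H (p ! j) (p ! i)"
        using pairwiseD[OF cl(1)] by metis
      then show "(x i, x j) \<in> K - Id \<longleftrightarrow> (y i, y j) \<in> L - Id"
        "(x j, x i) \<in> K - Id \<longleftrightarrow> (y j, y i) \<in> L - Id"
        by (auto simp: increasing_pair_def defs)
    qed
    \<comment> \<open>If \<open>x i\<close> and \<open>x j\<close> differ, alikeness lets
      \<open>x j\<close> and \<open>y j\<close> stand for \<open>x' j\<close> and
      \<open>y' j\<close>, and \<open>inc\<close> compares them inside \<open>p\<close>. If they
      agree, so do the entries \<open>i\<close> and \<open>j\<close> of \<open>x'\<close>,
      \<open>y\<close> and \<open>y'\<close>, and the upward moves decide.\<close>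
    have "((x i, x' j) \<in> K - Id \<longleftrightarrow> (y i, y' j) \<in> L - Id) \<and> ((x' j, x i) \<in> K - Id \<longleftrightarrow> (y' j, y i) \<in> L - Id)"
    proof (cases "x i = x j")
      case True
      then have "x' i = x' j" using aK(1,2) Linear_order_strict(2)[OF K(1) mem(3,4)] by auto
      moreover have y: "y i = y j" using True inc Linear_order_strict(2)[OF L(1) mem(5,6)] by auto
      moreover have "y' i = y' j" using y aL(1,2) Linear_order_strict(2)[OF L(1) mem(7,8)] by auto
      ultimately show ?thesis
        using up[OF ij(1)] Linear_order_strict(1)[OF K(1)] Linear_order_strict(1)[OF L(1)] by metis
    next
      case False
      then have "y i \<noteq> y j" using inc Linear_order_strict(2)[OF K(1) mem(1,2)] by auto
      with False aK(3,4) aL(3,4) inc show ?thesis by simp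
    qed
    then show ?thesis by (simp only: increasing_pair_def defs)
  qed
  have cross': "?H e e' \<and> ?H e' e" if "e \<in> set p" "e' \<in> set q" for e e'
    using that cross len_pq by (metis in_set_conv_nth)
  have "pairwise ?H (set p \<union> set q)"
  proof (rule pairwiseI)
    fix e e' assume "e \<in> set p \<union> set q" "e' \<in> set p \<union> set q" "e \<noteq> e'"
    then show "?H e e'" using pairwiseD[OF cl(1)] pairwiseD[OF cl(2)] cross' by blast
  qed
  with pq_\<Lambda> pq(3) show "\<exists>l\<in>\<Lambda>. \<exists>l'\<in>\<Lambda>. l \<noteq> l' \<and> pairwise ?H (set l \<union> set l')" by blast
qed

subsection \<open>The generic isomorphism\<close>

lemma increasing_pair_swap:
  "increasing_pair L K (prod.swap e) (prod.swap e') \<longleftrightarrow> increasing_pair K L e e'"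
  by (auto simp: increasing_pair_def)

lemma pairwise_increasing_swap:
  "pairwise (increasing_pair L K) (prod.swap ` p) \<longleftrightarrow> pairwise (increasing_pair K L) p"
  by (simp add: pairwise_image pairwise_def increasing_pair_swap inj_eq[OF inj_swap])

text \<open>Given by injections of \<open>A\<close> into the sets of \<open>\<V>\<close> and of \<open>B\<close> into the sets of \<open>\<U>\<close>.
  Restricting conditions to such a relation is what makes the poset of increasing maps ccc.\<close>

lemma obtain_countable_fibres_relation:
  assumes "|A| =o omega1" "|B| =o omega1"
    and \<U>: "countable \<U>" "\<forall>U\<in>\<U>. U \<subseteq> A \<and> |U| =o omega1"
    and \<V>: "countable \<V>" "\<forall>V\<in>\<V>. V \<subseteq> B \<and> |V| =o omega1"
  obtains E where "E \<subseteq> A \<times> B"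
    "\<forall>x. countable {e \<in> E. fst e = x}" "\<forall>y. countable {e \<in> E. snd e = y}"
    "\<forall>x\<in>A. \<forall>V\<in>\<V>. \<exists>y\<in>V. (x, y) \<in> E" "\<forall>y\<in>B. \<forall>U\<in>\<U>. \<exists>x\<in>U. (x, y) \<in> E"
proof -
  have "\<exists>h. bij_betw h A V" if "V \<in> \<V>" for V
    using \<V>(2)[rule_format, OF that] assms(1) by (meson card_of_ordIso ordIso_symmetric ordIso_transitive)
  then obtain h where h: "\<And>V. V \<in> \<V> \<Longrightarrow> bij_betw (h V) A V" by metis
  have "\<exists>g. bij_betw g B U" if "U \<in> \<U>" for U
    using \<U>(2)[rule_format, OF that] assms(2) by (meson card_of_ordIso ordIso_symmetric ordIso_transitive)
  then obtain g where g: "\<And>U. U \<in> \<U> \<Longrightarrow> bij_betw (g U) B U" by metis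
  \<comment> \<open>The fibre over a point has one pair per member of one family and, by
    injectivity, at most one per member of the other; both families are countable.\<close>
  define E where "E = (\<Union>V\<in>\<V>. (\<lambda>x. (x, h V x)) ` A) \<union> (\<Union>U\<in>\<U>. (\<lambda>y. (g U y, y)) ` B)"
  have h_in: "h V x \<in> V" if "V \<in> \<V>" "x \<in> A" for V x
    using h[OF that(1)] that(2) by (auto simp: bij_betw_def)
  have g_in: "g U y \<in> U" if "U \<in> \<U>" "y \<in> B" for U y
    using g[OF that(1)] that(2) by (auto simp: bij_betw_def)
  have fibre_h: "countable {x \<in> A. h V x = y}" if "V \<in> \<V>" for V y
    using countable_image_inj_gen[of "h V" A "{y}"] h[OF that] by (simp add: bij_betw_def)
  have fibre_g: "countable {y \<in> B. g U y = x}" if "U \<in> \<U>" for U x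
    using countable_image_inj_gen[of "g U" B "{x}"] g[OF that] by (simp add: bij_betw_def)
  show thesis
  proof (rule that)
    show "E \<subseteq> A \<times> B"
      using h_in g_in \<U>(2) \<V>(2) unfolding E_def by fast
    show "\<forall>x. countable {e \<in> E. fst e = x}"
    proof (rule allI, rule countable_subset)
      fix x
      show "{e \<in> E. fst e = x} \<subseteq>
        (\<Union>V\<in>\<V>. {(x, h V x)}) \<union> (\<Union>U\<in>\<U>. (\<lambda>y. (x, y)) ` {y \<in> B. g U y = x})"
        unfolding E_def by auto
      show "countable ((\<Union>V\<in>\<V>. {(x, h V x)}) \<union> (\<Union>U\<in>\<U>. (\<lambda>y. (x, y)) ` {y \<in> B. g U y = x}))"
        using \<U>(1) \<V>(1) fibre_g by simp
    qed
    show "\<forall>y. countable {e \<in> E. snd e = y}"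
    proof (rule allI, rule countable_subset)
      fix y
      show "{e \<in> E. snd e = y} \<subseteq>
        (\<Union>U\<in>\<U>. {(g U y, y)}) \<union> (\<Union>V\<in>\<V>. (\<lambda>x. (x, y)) ` {x \<in> A. h V x = y})"
        unfolding E_def by auto
      show "countable ((\<Union>U\<in>\<U>. {(g U y, y)}) \<union> (\<Union>V\<in>\<V>. (\<lambda>x. (x, y)) ` {x \<in> A. h V x = y}))"
        using \<U>(1) \<V>(1) fibre_h by simp
    qed
    show "\<forall>x\<in>A. \<forall>V\<in>\<V>. \<exists>y\<in>V. (x, y) \<in> E"
      using h_in unfolding E_def by blast
    show "\<forall>y\<in>B. \<forall>U\<in>\<U>. \<exists>x\<in>U. (x, y) \<in> E"
      using g_in unfolding E_def by blast
  qed
qed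

section \<open>Countable families of intervals\<close>

lemma finite_has_greatest:
  assumes r: "Linear_order r" and "finite A" "A \<noteq> {}" "A \<subseteq> Field r"
  shows "\<exists>m\<in>A. \<forall>a\<in>A. a = m \<or> (a, m) \<in> r - Id"
  using assms(2-4)
proof (induction rule: finite_ne_induct)
  case (insert x F)
  then obtain m where m: "m \<in> F" "\<forall>a\<in>F. a = m \<or> (a, m) \<in> r - Id" by auto
  have F: "x \<in> Field r" "m \<in> Field r" using insert.prems m(1) by auto
  show ?case
  proof (cases "(x, m) \<in> r - Id")
    case True
    then show ?thesis using m by auto
  next
    case False
    have "x \<noteq> m" using insert m(1) by auto
    then have "(m, x) \<in> r - Id" using Linear_order_strict(2)[OF r F] False by blast
    then have "a = x \<or> (a, x) \<in> r - Id" if "a \<in> insert x F" for a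
      using that m(2) Linear_order_strict(3)[OF r, of a m x] by (metis insertE)
    then show ?thesis by blast
  qed
qed simp

lemma finite_has_least:
  assumes r: "Linear_order r" and "finite A" "A \<noteq> {}" "A \<subseteq> Field r"
  shows "\<exists>m\<in>A. \<forall>a\<in>A. a = m \<or> (m, a) \<in> r - Id"
proof -
  have "\<exists>m\<in>A. \<forall>a\<in>A. a = m \<or> (a, m) \<in> r\<inverse> - Id"
    by (rule finite_has_greatest) (use assms in auto)
  then show ?thesis by auto
qed

text \<open>The greatest point of \<open>A\<close> and the least point of \<open>B\<close> bound the
  interval; an empty side leaves it unbounded there.\<close>

lemma open_interval_between:
  assumes r: "Linear_order r" and A: "finite A" "A \<subseteq> Field r" and B: "finite B" "B \<subseteq> Field r"
    and AB: "\<And>a b. a \<in> A \<Longrightarrow> b \<in> B \<Longrightarrow> (a, b) \<in> r - Id"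
  obtains I where "I \<in> open_intervals r"
    "\<forall>v\<in>I. (\<forall>a\<in>A. (a, v) \<in> r - Id) \<and> (\<forall>b\<in>B. (v, b) \<in> r - Id)"
proof -
  have trans: "(a, c) \<in> r - Id" if "a = b \<or> (a, b) \<in> r - Id" "(b, c) \<in> r - Id" for a b c
    using that Linear_order_strict(3)[OF r] by blast
  have trans': "(a, c) \<in> r - Id" if "(a, b) \<in> r - Id" "c = b \<or> (b, c) \<in> r - Id" for a b c
    using that Linear_order_strict(3)[OF r] by blast
  have A_above: "\<forall>a\<in>A. (a, v) \<in> r - Id"
    if "m \<in> A" "\<forall>a\<in>A. a = m \<or> (a, m) \<in> r - Id" "v \<in> aboveS r m" for m v
    using that trans[of _ m v] by (auto simp: aboveS_def)
  have B_below: "\<forall>b\<in>B. (v, b) \<in> r - Id"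
    if "n \<in> B" "\<forall>b\<in>B. b = n \<or> (n, b) \<in> r - Id" "v \<in> underS r n" for n v
    using that trans'[of v n] by (auto simp: underS_def)
  consider "A = {}" "B = {}" | "A = {}" "B \<noteq> {}" | "A \<noteq> {}" "B = {}" | "A \<noteq> {}" "B \<noteq> {}"
    by blast
  then show thesis
  proof cases
    case 1
    then show thesis by (intro that[of "Field r"]) (auto simp: open_intervals_def)
  next
    case 2
    obtain n where n: "n \<in> B" "\<forall>b\<in>B. b = n \<or> (n, b) \<in> r - Id"
      using finite_has_least[OF r B(1) 2(2) B(2)] by blast
    have "underS r n \<in> open_intervals r" using n(1) B(2) by (auto simp: open_intervals_def)
    then show thesis by (rule that) (use 2(1) B_below[OF n] in blast)
  next
    case 3
    obtain m where m: "m \<in> A" "\<forall>a\<in>A. a = m \<or> (a, m) \<in> r - Id"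
      using finite_has_greatest[OF r A(1) 3(1) A(2)] by blast
    have "aboveS r m \<in> open_intervals r" using m(1) A(2) by (auto simp: open_intervals_def)
    then show thesis by (rule that) (use 3(2) A_above[OF m] in blast)
  next
    case 4
    obtain m where m: "m \<in> A" "\<forall>a\<in>A. a = m \<or> (a, m) \<in> r - Id"
      using finite_has_greatest[OF r A(1) 4(1) A(2)] by blast
    obtain n where n: "n \<in> B" "\<forall>b\<in>B. b = n \<or> (n, b) \<in> r - Id"
      using finite_has_least[OF r B(1) 4(2) B(2)] by blast
    have "aboveS r m \<inter> underS r n \<in> open_intervals r"
      using AB[OF m(1) n(1)] unfolding open_intervals_def by blast
    then show thesis by (rule that) (use A_above[OF m] B_below[OF n] in blast)
  qed
qed

text \<open>Intervals between points of a countable dense set suffice, since the gap between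
  \<open>A\<close> and \<open>B\<close> contains one of them. Countability of \<open>\<V>\<close>
  later keeps the fibres of the relation between the two orders countable.\<close>

lemma obtain_countable_base:
  assumes r: "Linear_order r" and sep: "separable_order r" and dense: "omega1_dense r"
  obtains \<V> where "countable \<V>" "\<forall>V\<in>\<V>. V \<subseteq> Field r \<and> |V| =o omega1"
    "\<forall>A B. finite A \<and> A \<subseteq> Field r \<and> finite B \<and> B \<subseteq> Field r \<and>
        (\<forall>a\<in>A. \<forall>b\<in>B. (a, b) \<in> r - Id) \<longrightarrow>
      (\<exists>V\<in>\<V>. \<forall>v\<in>V. (\<forall>a\<in>A. (a, v) \<in> r - Id) \<and> (\<forall>b\<in>B. (v, b) \<in> r - Id))"
proof -
  obtain C where C: "C \<subseteq> Field r" "countable C" "\<forall>I\<in>open_intervals r. I \<noteq> {} \<longrightarrow> C \<inter> I \<noteq> {}"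
    using sep unfolding separable_order_def by (elim exE conjE)
  have big: "|I| =o omega1" if "I \<in> open_intervals r" for I
    using dense that by (auto simp: omega1_dense_def)
  define J where "J c d = aboveS r c \<inter> underS r d" for c d
  define \<V> where "\<V> = (\<lambda>(c, d). J c d) ` ((C \<times> C) \<inter> (r - Id))"
  have J_iff: "v \<in> J c d \<longleftrightarrow> (c, v) \<in> r - Id \<and> (v, d) \<in> r - Id" for v c d
    by (auto simp: J_def aboveS_def underS_def)
  have J: "J c d \<in> open_intervals r" if "(c, d) \<in> r - Id" for c d
    using that unfolding open_intervals_def J_def by blast
  have J_\<V>: "J c d \<in> \<V>" if "c \<in> C" "d \<in> C" "(c, d) \<in> r - Id" for c d
    using that unfolding \<V>_def by force
  have between: "\<exists>c\<in>C. (x, c) \<in> r - Id \<and> (c, y) \<in> r - Id" if "(x, y) \<in> r - Id" for x y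
  proof -
    have "J x y \<noteq> {}" using dense J[OF that] by (simp add: omega1_dense_def)
    then have "C \<inter> J x y \<noteq> {}" using C(3) J[OF that] by simp
    then obtain c where "c \<in> C" "c \<in> J x y" by auto
    then show ?thesis unfolding J_iff by (rule bexI[rotated])
  qed
  note trans = Linear_order_strict(3)[OF r]
  show thesis
  proof (rule that)
    show "countable \<V>" using C(2) by (auto simp: \<V>_def)
    show "\<forall>V\<in>\<V>. V \<subseteq> Field r \<and> |V| =o omega1"
    proof
      fix V assume "V \<in> \<V>"
      then obtain c d where cd: "(c, d) \<in> r - Id" "V = J c d" unfolding \<V>_def by auto
      have "J c d \<subseteq> Field r" by (auto simp: J_def aboveS_def Field_def)
      with cd(2) big[OF J[OF cd(1)]] show "V \<subseteq> Field r \<and> |V| =o omega1" by simp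
    qed
    show "\<forall>A B. finite A \<and> A \<subseteq> Field r \<and> finite B \<and> B \<subseteq> Field r \<and>
        (\<forall>a\<in>A. \<forall>b\<in>B. (a, b) \<in> r - Id) \<longrightarrow>
      (\<exists>V\<in>\<V>. \<forall>v\<in>V. (\<forall>a\<in>A. (a, v) \<in> r - Id) \<and> (\<forall>b\<in>B. (v, b) \<in> r - Id))"
    proof (intro allI impI, elim conjE)
      fix A B
      assume AB: "finite A" "A \<subseteq> Field r" "finite B" "B \<subseteq> Field r"
        "\<forall>a\<in>A. \<forall>b\<in>B. (a, b) \<in> r - Id"
      obtain I where I: "I \<in> open_intervals r"
        "\<forall>v\<in>I. (\<forall>a\<in>A. (a, v) \<in> r - Id) \<and> (\<forall>b\<in>B. (v, b) \<in> r - Id)"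
        by (rule open_interval_between[OF r AB(1-4) AB(5)[rule_format]])
      have "uncountable I" using big[OF I(1)] by (rule uncountable_if_ordIso_omega1)
      then obtain x y where xy: "x \<in> I" "y \<in> I" "x \<noteq> y" by (rule uncountable_obtain_two)
      have "I \<subseteq> Field r"
        using I(1) by (auto simp: open_intervals_def aboveS_def underS_def Field_def)
      then have "(x, y) \<in> r - Id \<or> (y, x) \<in> r - Id"
        using Linear_order_strict(2)[OF r] xy by blast
      then obtain x' y' where xy': "x' \<in> I" "y' \<in> I" "(x', y') \<in> r - Id" using xy by blast
      \<comment> \<open>Two successive choices between \<open>x'\<close> and \<open>y'\<close> give
        points \<open>c\<close> and \<open>d\<close> of \<open>C\<close> in increasing order, so
        that \<open>J c d\<close> lies within the gap.\<close>
      then obtain c where c: "c \<in> C" "(x', c) \<in> r - Id" "(c, y') \<in> r - Id" using between by blast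
      then obtain d where d: "d \<in> C" "(c, d) \<in> r - Id" "(d, y') \<in> r - Id" using between by blast
      have "J c d \<in> \<V>" by (rule J_\<V>[OF c(1) d(1,2)])
      moreover have "(\<forall>a\<in>A. (a, v) \<in> r - Id) \<and> (\<forall>b\<in>B. (v, b) \<in> r - Id)" if "v \<in> J c d" for v
      proof -
        have "(c, v) \<in> r - Id" "(v, d) \<in> r - Id" using that unfolding J_iff by simp_all
        then have "(x', v) \<in> r - Id" "(v, y') \<in> r - Id"
          using trans[OF c(2)] trans[OF _ d(3)] by simp_all
        then show ?thesis
          using I(2)[rule_format, OF xy'(1)] I(2)[rule_format, OF xy'(2)] trans[of _ x' v] trans[of v y'] by blast
      qed
      ultimately show "\<exists>V\<in>\<V>. \<forall>v\<in>V. (\<forall>a\<in>A. (a, v) \<in> r - Id) \<and> (\<forall>b\<in>B. (v, b) \<in> r - Id)"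
        by (intro bexI[of _ "J c d"]) simp_all
    qed
  qed
qed

section \<open>Extending conditions and reading off the isomorphism\<close>

lemma extend_increasing:
  assumes K: "Linear_order K" and L: "Linear_order L"
    and sections: "\<And>x A B. \<lbrakk>x \<in> Field K; finite A; A \<subseteq> Field L; finite B; B \<subseteq> Field L;
        \<And>a b. a \<in> A \<Longrightarrow> b \<in> B \<Longrightarrow> (a, b) \<in> L - Id\<rbrakk> \<Longrightarrow>
      \<exists>y. (x, y) \<in> E \<and> (\<forall>a\<in>A. (a, y) \<in> L - Id) \<and> (\<forall>b\<in>B. (y, b) \<in> L - Id)"
    and E: "E \<subseteq> Field K \<times> Field L"
    and p: "p \<in> finite_cliques E (increasing_pair K L)" and x: "x \<in> Field K"
  shows "\<exists>d\<in>finite_cliques E (increasing_pair K L). p \<subseteq> d \<and> x \<in> fst ` d"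
proof (cases "x \<in> fst ` p")
  case True
  with p show ?thesis by blast
next
  case False
  have p': "finite p" "p \<subseteq> E" "pairwise (increasing_pair K L) p"
    using p by (auto simp: finite_cliques_def Fpow_def)
  have pF: "a \<in> Field K" "b \<in> Field L" if "(a, b) \<in> p" for a b using that p'(2) E by auto
  \<comment> \<open>\<open>A\<close> and \<open>B\<close> hold the values of \<open>p\<close> at
    points below and above \<open>x\<close>. As \<open>p\<close> is increasing, \<open>A\<close>
    lies below \<open>B\<close>, and the new value is sought between them in the section of
    \<open>E\<close> at \<open>x\<close>.\<close>
  define A where "A = snd ` {e \<in> p. (fst e, x) \<in> K - Id}"
  define B where "B = snd ` {e \<in> p. (x, fst e) \<in> K - Id}"
  have AB: "(a, b) \<in> L - Id" if ab: "a \<in> A" "b \<in> B" for a b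
  proof -
    obtain e e' where e: "e \<in> p" "(fst e, x) \<in> K - Id" "a = snd e"
        "e' \<in> p" "(x, fst e') \<in> K - Id" "b = snd e'"
      using ab unfolding A_def B_def by blast
    then have lt: "(fst e, fst e') \<in> K - Id" using Linear_order_strict(3)[OF K] by blast
    then have "e \<noteq> e'" by auto
    with lt e show ?thesis using pairwiseD[OF p'(3) e(1) e(4)] by (simp add: increasing_pair_def)
  qed
  have "finite A" "finite B" "A \<subseteq> Field L" "B \<subseteq> Field L"
    using p'(1) pF by (auto simp: A_def B_def)
  then obtain y where y: "(x, y) \<in> E" "\<forall>a\<in>A. (a, y) \<in> L - Id" "\<forall>b\<in>B. (y, b) \<in> L - Id"
    using sections[OF x, of A B] AB by blast
  have inc: "increasing_pair K L (x, y) e \<and> increasing_pair K L e (x, y)" if e: "e \<in> p" for e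
  proof -
    have "fst e \<noteq> x" using False e by auto
    moreover have "fst e \<in> Field K" using pF[of "fst e" "snd e"] e by simp
    ultimately have "(fst e, x) \<in> K - Id \<or> (x, fst e) \<in> K - Id"
      using Linear_order_strict(2)[OF K _ x] by blast
    then show ?thesis
    proof
      assume lt: "(fst e, x) \<in> K - Id"
      then have "(snd e, y) \<in> L - Id" using y(2) e unfolding A_def by blast
      with lt Linear_order_strict(1)[OF K lt] Linear_order_strict(1)[OF L this]
      show ?thesis by (simp only: increasing_pair_def fst_conv snd_conv simp_thms)
    next
      assume gt: "(x, fst e) \<in> K - Id"
      then have "(y, snd e) \<in> L - Id" using y(3) e unfolding B_def by blast
      with gt Linear_order_strict(1)[OF K gt] Linear_order_strict(1)[OF L this]
      show ?thesis by (simp only: increasing_pair_def fst_conv snd_conv simp_thms)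
    qed
  qed
  have "insert (x, y) p \<in> finite_cliques E (increasing_pair K L)"
    using p' y(1) inc by (simp add: finite_cliques_def Fpow_def pairwise_insert)
  then show ?thesis by (intro bexI[of _ "insert (x, y) p"]) auto
qed

text \<open>Increase in both directions and totality make first coordinates equal exactly when
  second coordinates are, so \<open>G\<close> is the graph of a bijection.\<close>

lemma order_isomorphic_if_increasing_relation:
  assumes K: "Linear_order K" and L: "Linear_order L"
    and G: "G \<subseteq> Field K \<times> Field L" "pairwise (increasing_pair K L) G"
      "fst ` G = Field K" "snd ` G = Field L"
  shows "order_isomorphic K L"
proof -
  have inc: "(a, a') \<in> K - Id \<longleftrightarrow> (b, b') \<in> L - Id" if "(a, b) \<in> G" "(a', b') \<in> G" for a b a' b'
  proof (cases "(a, b) = (a', b')")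
    case False
    with pairwiseD[OF G(2) that] show ?thesis by (simp add: increasing_pair_def)
  qed auto
  have eq: "a = a' \<longleftrightarrow> b = b'" if ab: "(a, b) \<in> G" "(a', b') \<in> G" for a b a' b'
  proof -
    have "a \<in> Field K" "a' \<in> Field K" "b \<in> Field L" "b' \<in> Field L" using ab G(1) by auto
    then show ?thesis
      using inc[OF ab] inc[OF ab(2,1)] Linear_order_strict(2)[OF K, of a a']
        Linear_order_strict(2)[OF L, of b b'] by auto
  qed
  define f where "f a = (SOME b. (a, b) \<in> G)" for a
  have f: "(a, f a) \<in> G" if "a \<in> Field K" for a
  proof -
    have "\<exists>b. (a, b) \<in> G" using that G(3) by force
    then show ?thesis unfolding f_def by (rule someI_ex)
  qed
  have "inj_on f (Field K)"
    using f eq by (metis inj_onI)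
  moreover have "f ` Field K = Field L"
  proof
    show "f ` Field K \<subseteq> Field L" using f G(1) by blast
    show "Field L \<subseteq> f ` Field K"
    proof
      fix b assume "b \<in> Field L"
      then obtain a where a: "(a, b) \<in> G" using G(4) by force
      then have "a \<in> Field K" using G(1) by blast
      with a f eq show "b \<in> f ` Field K" by blast
    qed
  qed
  moreover have "(a, b) \<in> K \<longleftrightarrow> (f a, f b) \<in> L" if ab: "a \<in> Field K" "b \<in> Field K" for a b
  proof (cases "a = b")
    case True
    have "(a, a) \<in> K" "(f a, f a) \<in> L"
      using K L ab(1) f[OF ab(1)] G(1)
      by (auto simp: linear_order_on_def partial_order_on_def preorder_on_def refl_on_def)
    then show ?thesis using True by simp
  next
    case False
    then have "f a \<noteq> f b" using eq[OF f[OF ab(1)] f[OF ab(2)]] by simp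
    with False inc[OF f[OF ab(1)] f[OF ab(2)]] show ?thesis by simp
  qed
  ultimately have "iso K L f" by (simp add: iso_iff2 bij_betw_def)
  then show ?thesis unfolding order_isomorphic_def by blast
qed

lemma order_isomorphic_if_not_common_suborder:
  fixes K :: "'a rel" and L :: "'b rel"
  assumes MA: "MA_omega1"
    and K: "Linear_order K" "separable_order K" "omega1_dense K" "rectangular_order K"
    and L: "Linear_order L" "separable_order L" "omega1_dense L" "rectangular_order L"
    and no_common: "\<not> common_uncountable_suborder K (L\<inverse>)"
  shows "order_isomorphic K L"
proof -
  have FK: "|Field K| =o omega1" and FL: "|Field L| =o omega1"
    using K(3) L(3) by (auto simp: omega1_dense_def open_intervals_def)
  obtain \<U> where \<U>: "countable \<U>" "\<forall>U\<in>\<U>. U \<subseteq> Field K \<and> |U| =o omega1"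
    and \<U>_base: "\<forall>A B. finite A \<and> A \<subseteq> Field K \<and> finite B \<and> B \<subseteq> Field K \<and>
        (\<forall>a\<in>A. \<forall>b\<in>B. (a, b) \<in> K - Id) \<longrightarrow>
      (\<exists>U\<in>\<U>. \<forall>v\<in>U. (\<forall>a\<in>A. (a, v) \<in> K - Id) \<and> (\<forall>b\<in>B. (v, b) \<in> K - Id))"
    by (rule obtain_countable_base[OF K(1-3)])
  obtain \<V> where \<V>: "countable \<V>" "\<forall>V\<in>\<V>. V \<subseteq> Field L \<and> |V| =o omega1"
    and \<V>_base: "\<forall>A B. finite A \<and> A \<subseteq> Field L \<and> finite B \<and> B \<subseteq> Field L \<and>
        (\<forall>a\<in>A. \<forall>b\<in>B. (a, b) \<in> L - Id) \<longrightarrow>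
      (\<exists>V\<in>\<V>. \<forall>v\<in>V. (\<forall>a\<in>A. (a, v) \<in> L - Id) \<and> (\<forall>b\<in>B. (v, b) \<in> L - Id))"
    by (rule obtain_countable_base[OF L(1-3)])
  \<comment> \<open>\<open>E\<close> is rich enough for density, as its sections meet every base
    interval, and thin enough for the ccc, as its fibres are countable.\<close>
  obtain E where E: "E \<subseteq> Field K \<times> Field L"
    and fibres: "\<forall>x. countable {e \<in> E. fst e = x}" "\<forall>y. countable {e \<in> E. snd e = y}"
    and sections: "\<forall>x\<in>Field K. \<forall>V\<in>\<V>. \<exists>y\<in>V. (x, y) \<in> E"
      "\<forall>y\<in>Field L. \<forall>U\<in>\<U>. \<exists>x\<in>U. (x, y) \<in> E"
    by (rule obtain_countable_fibres_relation[OF FK FL \<U> \<V>])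
  let ?H = "increasing_pair K L"
  have ccc: "ccc_cliques E ?H"
    by (rule ccc_cliques_increasing[OF MA K(1,4) L(1,4) no_common E fibres[rule_format]])
  have ext_K: "\<exists>d\<in>finite_cliques E ?H. p \<subseteq> d \<and> x \<in> fst ` d"
    if "p \<in> finite_cliques E ?H" "x \<in> Field K" for p x
  proof (rule extend_increasing[OF K(1) L(1) _ E that])
    fix x A B
    assume x: "x \<in> Field K" and AB: "finite A" "A \<subseteq> Field L" "finite B" "B \<subseteq> Field L"
      "\<And>a b. a \<in> A \<Longrightarrow> b \<in> B \<Longrightarrow> (a, b) \<in> L - Id"
    have "\<exists>V\<in>\<V>. \<forall>v\<in>V. (\<forall>a\<in>A. (a, v) \<in> L - Id) \<and> (\<forall>b\<in>B. (v, b) \<in> L - Id)"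
      by (intro \<V>_base[THEN spec, THEN spec, THEN mp] conjI ballI AB)
    then obtain V
      where V: "V \<in> \<V>" "\<forall>v\<in>V. (\<forall>a\<in>A. (a, v) \<in> L - Id) \<and> (\<forall>b\<in>B. (v, b) \<in> L - Id)"
      by (elim bexE)
    obtain y where "y \<in> V" "(x, y) \<in> E" using sections(1) x V(1) by blast
    with V(2) show "\<exists>y. (x, y) \<in> E \<and> (\<forall>a\<in>A. (a, y) \<in> L - Id) \<and> (\<forall>b\<in>B. (y, b) \<in> L - Id)" by blast
  qed
  \<comment> \<open>Adding a point to the range of a map adds it to the domain of the inverse, so
    \<open>extend_increasing\<close> applies with \<open>K\<close> and \<open>L\<close>
    exchanged.\<close>
  let ?E' = "prod.swap ` E" and ?H' = "increasing_pair L K"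
  have swap: "prod.swap ` p \<in> finite_cliques ?E' ?H'" if "p \<in> finite_cliques E ?H" for p
    using that by (auto simp: finite_cliques_def Fpow_def pairwise_increasing_swap)
  have swap': "prod.swap ` p \<in> finite_cliques E ?H" if "p \<in> finite_cliques ?E' ?H'" for p
    using that pairwise_increasing_swap[of K L p] by (auto simp: finite_cliques_def Fpow_def)
  have ext_L: "\<exists>d\<in>finite_cliques E ?H. p \<subseteq> d \<and> y \<in> snd ` d"
    if p: "p \<in> finite_cliques E ?H" and y: "y \<in> Field L" for p y
  proof -
    have "\<exists>d\<in>finite_cliques ?E' ?H'. prod.swap ` p \<subseteq> d \<and> y \<in> fst ` d"
    proof (rule extend_increasing[OF L(1) K(1) _ _ swap[OF p] y])
      show "?E' \<subseteq> Field L \<times> Field K" using E by auto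
      fix y A B
      assume y: "y \<in> Field L" and AB: "finite A" "A \<subseteq> Field K" "finite B" "B \<subseteq> Field K"
        "\<And>a b. a \<in> A \<Longrightarrow> b \<in> B \<Longrightarrow> (a, b) \<in> K - Id"
      have "\<exists>U\<in>\<U>. \<forall>v\<in>U. (\<forall>a\<in>A. (a, v) \<in> K - Id) \<and> (\<forall>b\<in>B. (v, b) \<in> K - Id)"
        by (intro \<U>_base[THEN spec, THEN spec, THEN mp] conjI ballI AB)
      then obtain U
        where U: "U \<in> \<U>" "\<forall>v\<in>U. (\<forall>a\<in>A. (a, v) \<in> K - Id) \<and> (\<forall>b\<in>B. (v, b) \<in> K - Id)"
        by (elim bexE)
      obtain x where "x \<in> U" "(x, y) \<in> E" using sections(2) y U(1) by blast
      moreover from this(2) have "(y, x) \<in> ?E'" by force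
      ultimately show "\<exists>x. (y, x) \<in> ?E' \<and> (\<forall>a\<in>A. (a, x) \<in> K - Id) \<and> (\<forall>b\<in>B. (x, b) \<in> K - Id)"
        using U(2) by blast
    qed
    then obtain d where d: "d \<in> finite_cliques ?E' ?H'" "prod.swap ` p \<subseteq> d" "y \<in> fst ` d" by blast
    have "p \<subseteq> prod.swap ` d" using d(2) by (force simp: image_iff)
    moreover have "y \<in> snd ` prod.swap ` d" using d(3) by force
    ultimately show ?thesis using swap'[OF d(1)] by blast
  qed
  \<comment> \<open>At most \<open>omega1\<close> requirements, which make the generic map total and
    onto.\<close>
  define \<D> where "\<D> = (\<lambda>x. {d. x \<in> fst ` d}) ` Field K \<union> (\<lambda>y. {d :: ('a \<times> 'b) set. y \<in> snd ` d}) ` Field L"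
  have FK': "|Field K| \<le>o omega1" and FL': "|Field L| \<le>o omega1"
    using FK FL ordIso_imp_ordLeq by blast+
  have "|E| \<le>o omega1"
    by (rule subset_ordLeq_omega1[OF E Times_ordLeq_omega1[OF FK' FL']])
  \<comment> \<open>Every condition can be extended as required, so the forcing may start from the
    empty map.\<close>
  moreover have "{} \<in> finite_cliques E ?H" by (simp add: finite_cliques_def Fpow_def)
  moreover have "|\<D>| \<le>o omega1"
    unfolding \<D>_def by (intro Un_ordLeq_omega1 image_ordLeq_omega1 FK' FL')
  moreover have "\<exists>d\<in>D. d \<in> finite_cliques E ?H \<and> p \<subseteq> d"
    if D: "D \<in> \<D>" and p: "p \<in> finite_cliques E ?H" and "{} \<subseteq> p" for D p
  proof -
    from D consider x where "x \<in> Field K" "D = {d. x \<in> fst ` d}"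
      | y where "y \<in> Field L" "D = {d. y \<in> snd ` d}" unfolding \<D>_def by blast
    then show ?thesis
    proof cases
      case 1
      then show ?thesis using ext_K[OF p 1(1)] by blast
    next
      case 2
      then show ?thesis using ext_L[OF p 2(1)] by blast
    qed
  qed
  ultimately obtain G where G: "G \<subseteq> E" "pairwise ?H G" "\<forall>D\<in>\<D>. \<exists>d\<in>D. d \<subseteq> G"
    by (rule MA_cliques[OF MA _ ccc])
  have "fst ` G = Field K"
  proof
    show "fst ` G \<subseteq> Field K" using G(1) E by auto
    show "Field K \<subseteq> fst ` G"
    proof
      fix x assume "x \<in> Field K"
      then have "{d. x \<in> fst ` d} \<in> \<D>" by (simp add: \<D>_def)
      with G(3) have "\<exists>d\<in>{d. x \<in> fst ` d}. d \<subseteq> G" by (rule bspec)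
      then obtain d where "x \<in> fst ` d" "d \<subseteq> G" by blast
      then show "x \<in> fst ` G" by auto
    qed
  qed
  moreover have "snd ` G = Field L"
  proof
    show "snd ` G \<subseteq> Field L" using G(1) E by auto
    show "Field L \<subseteq> snd ` G"
    proof
      fix y assume "y \<in> Field L"
      then have "{d. y \<in> snd ` d} \<in> \<D>" by (simp add: \<D>_def)
      with G(3) have "\<exists>d\<in>{d. y \<in> snd ` d}. d \<subseteq> G" by (rule bspec)
      then obtain d where "y \<in> snd ` d" "d \<subseteq> G" by blast
      then show "y \<in> snd ` G" by auto
    qed
  qed
  moreover have "G \<subseteq> Field K \<times> Field L" using G(1) E by blast
  ultimately show ?thesis
    using order_isomorphic_if_increasing_relation[OF K(1) L(1) _ G(2)] by blast
qed

theorem mainTheorem15: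
  fixes K :: "'a rel" and L :: "'b rel"
  assumes "MA_omega1"
    and "Linear_order K" and "separable_order K" and "omega1_dense K" and "rectangular_order K"
    and "Linear_order L" and "separable_order L" and "omega1_dense L" and "rectangular_order L"
  shows "order_isomorphic K L \<longleftrightarrow> \<not> common_uncountable_suborder K (L\<inverse>)"
  using not_common_suborder_if_iso[OF assms(2,6,9)]
    order_isomorphic_if_not_common_suborder[OF assms] by blast

end
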